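(* Let $(M,\tilde\varphi,\xi,\eta,\tilde g)$ be a connected $(2n+1)$-dimensional paracontact metric $(\tilde\kappa,\tilde\mu,\tilde\nu)$-manifold with $\tilde\kappa\neq-1$ (everywhere) and $n>1$. Then $M$ is a paracontact metric $(\tilde\kappa,\tilde\mu)$-manifold, i.e. $\tilde\kappa,\tilde\mu$ are constants and $\tilde\nu$ is the zero function.
   Context: A paracontact metric manifold $(M^{2n+1},\tilde\varphi,\xi,\eta,\tilde g)$ is a smooth manifold with a $(1,1)$-tensor field $\tilde\varphi$, a vector field $\xi$, a $1$-form $\eta$ and a pseudo-Riemannian metric $\tilde g$ such that: $\eta(\xi)=1$ and $\tilde\varphi^2=I-\eta\otimes\xi$; the $\pm1$-eigendistributions of $\tilde\varphi$ on $\ker\eta$ both have dimension $n$; $\tilde g(\tilde\varphi X,\tilde\varphi Y)=-\tilde g(X,Y)+\eta(X)\eta(Y)$; and $d\eta(X,Y)=\tilde g(X,\tilde\varphi Y)$, where $2d\eta(X,Y)=X\eta(Y)-Y\eta(X)-\eta([X,Y])$. One sets $\tilde h=\frac12\mathcal L_\xi\tilde\varphi$. $\tilde R(X,Y)=[\tilde\nabla_X,\tilde\nabla_Y]-\tilde\nabla_{[X,Y]}$ is the curvature of the Levi-Civita connection $\tilde\nabla$. A paracontact metric $(\tilde\kappa,\tilde\mu,\tilde\nu)$-manifold is a paracontact metric manifold for which there are smooth functions $\tilde\kappa,\tilde\mu,\tilde\nu$ on $M$ with $$\tilde R(X,Y)\xi=\tilde\kappa(\eta(Y)X-\eta(X)Y)+\tilde\mu(\eta(Y)\tilde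 hX-\eta(X)\tilde hY)+\tilde\nu(\eta(Y)\tilde\varphi\tilde hX-\eta(X)\tilde\varphi\tilde hY)$$ for all vector fields $X,Y$. Standing assumption: with $\tilde\lambda=\sqrt{|1+\tilde\kappa|}$, the index (of the restriction of $\tilde g$) of the eigendistributions of $\tilde h$ for $\pm\tilde\lambda$ (if $\tilde\kappa>-1$), respectively of $\tilde\varphi\tilde h$ for $\pm\tilde\lambda$ (if $\tilde\kappa<-1$), is constant. *)

theory Defs
  imports "HOL-Analysis.Analysis" "HOL-Library.Function_Algebras"
begin

text \<open>Pointwise real vector space structure on functions (addition comes from
  \<^theory>\<open>HOL-Library.Function_Algebras\<close>). It is used both for tangent vectors, which are
  functionals, and for vector fields.\<close>

instantiation "fun" :: (type, real_vector) real_vector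
begin

definition scaleR_fun :: "real \<Rightarrow> ('a \<Rightarrow> 'b) \<Rightarrow> 'a \<Rightarrow> 'b"
  where "scaleR_fun r f = (\<lambda>x. r *\<^sub>R f x)"

instance
  by standard (simp_all add: scaleR_fun_def fun_eq_iff scaleR_add_right scaleR_add_left)

end

subsection \<open>Smooth manifolds\<close>

text \<open>\<open>Ck_on k S f\<close> is meant for open \<open>S\<close>.\<close>

primrec Ck_on :: "nat \<Rightarrow> 'b::real_normed_vector set \<Rightarrow> ('b \<Rightarrow> 'c::real_normed_vector) \<Rightarrow> bool" where
  "Ck_on 0 S f \<longleftrightarrow> continuous_on S f"
| "Ck_on (Suc k) S f \<longleftrightarrow> (\<forall>x\<in>S. f differentiable (at x)) \<and>
     (\<forall>v. Ck_on k S (\<lambda>x. frechet_derivative f (at x) v))"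

definition smooth_on :: "'b::real_normed_vector set \<Rightarrow> ('b \<Rightarrow> 'c::real_normed_vector) \<Rightarrow> bool" where
  "smooth_on S f \<longleftrightarrow> (\<forall>k. Ck_on k S f)"

text \<open>A chart is a pair of its domain and its coordinate map (only relevant on the domain).
  The manifold is the whole type \<open>'a\<close>; atlases need not be maximal.\<close>

type_synonym ('a, 'e) atlas = "('a set \<times> ('a \<Rightarrow> 'e)) set"

definition smooth_manifold ::
  "('a::{t2_space,second_countable_topology}, 'e::euclidean_space) atlas \<Rightarrow> bool" where
  "smooth_manifold A \<longleftrightarrow>
     (\<forall>(U, c)\<in>A. open U \<and> open (c ` U) \<and> homeomorphism U (c ` U) c (inv_into U c)) \<and>
     (\<Union>(U, c)\<in>A. U) = UNIV \<and>
     (\<forall>(U, c)\<in>A. \<forall>(V, d)\<in>A. smooth_on (c ` (U \<inter> V)) (d \<circ> inv_into U c))"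

definition smooth_funs ::
  "('a::topological_space, 'e::euclidean_space) atlas \<Rightarrow> ('a \<Rightarrow> real) set" where
  "smooth_funs A = {f. \<forall>(U, c)\<in>A. smooth_on (c ` U) (f \<circ> inv_into U c)}"

type_synonym 'a tvec = "('a \<Rightarrow> real) \<Rightarrow> real"
type_synonym 'a vfield = "'a \<Rightarrow> 'a tvec"

text \<open>Tangent vectors at \<open>p\<close> are the derivations at \<open>p\<close> of the algebra of smooth functions; they
  are set to 0 on non-smooth functions, so that equal derivations are equal as HOL functions.\<close>

definition tangent_space ::
  "('a::topological_space, 'e::euclidean_space) atlas \<Rightarrow> 'a \<Rightarrow> 'a tvec set" where
  "tangent_space A p = {v.
     (\<forall>f\<in>smooth_funs A. \<forall>g\<in>smooth_funs A. v (\<lambda>q. f q + g q) = v f + v g) \<and>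
     (\<forall>r. \<forall>f\<in>smooth_funs A. v (\<lambda>q. r * f q) = r * v f) \<and>
     (\<forall>f\<in>smooth_funs A. \<forall>g\<in>smooth_funs A. v (\<lambda>q. f q * g q) = f p * v g + g p * v f) \<and>
     (\<forall>f. f \<notin> smooth_funs A \<longrightarrow> v f = 0)}"

text \<open>Smooth vector fields; \<open>\<lambda>p. X p f\<close> is the function \<open>X f\<close>.\<close>

definition vector_fields ::
  "('a::topological_space, 'e::euclidean_space) atlas \<Rightarrow> 'a vfield set" where
  "vector_fields A = {X. (\<forall>p. X p \<in> tangent_space A p) \<and>
     (\<forall>f\<in>smooth_funs A. (\<lambda>p. X p f) \<in> smooth_funs A)}"

definition fmult :: "('a \<Rightarrow> real) \<Rightarrow> 'a vfield \<Rightarrow> 'a vfield" where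
  "fmult f X = (\<lambda>p. f p *\<^sub>R X p)"

text \<open>On non-smooth \<open>f\<close> this is 0, since both inner functions vanish identically.\<close>

definition lie_bracket :: "'a vfield \<Rightarrow> 'a vfield \<Rightarrow> 'a vfield" where
  "lie_bracket X Y = (\<lambda>p f. X p (\<lambda>q. Y q f) - Y p (\<lambda>q. X q f))"

subsection \<open>Tensor fields\<close>

type_synonym 'a one_form = "'a \<Rightarrow> 'a tvec \<Rightarrow> real"
type_synonym 'a endo_field = "'a \<Rightarrow> 'a tvec \<Rightarrow> 'a tvec"
type_synonym 'a bilin_field = "'a \<Rightarrow> 'a tvec \<Rightarrow> 'a tvec \<Rightarrow> real"

definition eval1 :: "'a one_form \<Rightarrow> 'a vfield \<Rightarrow> 'a \<Rightarrow> real" where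
  "eval1 \<omega> X = (\<lambda>p. \<omega> p (X p))"

definition eval2 :: "'a bilin_field \<Rightarrow> 'a vfield \<Rightarrow> 'a vfield \<Rightarrow> 'a \<Rightarrow> real" where
  "eval2 g X Y = (\<lambda>p. g p (X p) (Y p))"

definition app :: "'a endo_field \<Rightarrow> 'a vfield \<Rightarrow> 'a vfield" where
  "app T X = (\<lambda>p. T p (X p))"

definition is_one_form ::
  "('a::topological_space, 'e::euclidean_space) atlas \<Rightarrow> 'a one_form \<Rightarrow> bool" where
  "is_one_form A \<omega> \<longleftrightarrow>
     (\<forall>p. \<forall>v\<in>tangent_space A p. \<forall>w\<in>tangent_space A p. \<omega> p (v + w) = \<omega> p v + \<omega> p w) \<and>
     (\<forall>p r. \<forall>v\<in>tangent_space A p. \<omega> p (r *\<^sub>R v) = r * \<omega> p v) \<and>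
     (\<forall>X\<in>vector_fields A. eval1 \<omega> X \<in> smooth_funs A)"

definition is_endo_field ::
  "('a::topological_space, 'e::euclidean_space) atlas \<Rightarrow> 'a endo_field \<Rightarrow> bool" where
  "is_endo_field A T \<longleftrightarrow>
     (\<forall>p. \<forall>v\<in>tangent_space A p. T p v \<in> tangent_space A p) \<and>
     (\<forall>p. \<forall>v\<in>tangent_space A p. \<forall>w\<in>tangent_space A p. T p (v + w) = T p v + T p w) \<and>
     (\<forall>p r. \<forall>v\<in>tangent_space A p. T p (r *\<^sub>R v) = r *\<^sub>R T p v) \<and>
     (\<forall>X\<in>vector_fields A. app T X \<in> vector_fields A)"

text \<open>The index of a symmetric bilinear form on a finite-dimensional space \<open>D\<close>.\<close>

definition form_index :: "('v::real_vector \<Rightarrow> 'v \<Rightarrow> real) \<Rightarrow> 'v set \<Rightarrow> nat" where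
  "form_index B D = Max {dim W | W. subspace W \<and> W \<subseteq> D \<and> (\<forall>w\<in>W. w \<noteq> 0 \<longrightarrow> B w w < 0)}"

definition pseudo_riemannian_metric ::
  "('a::topological_space, 'e::euclidean_space) atlas \<Rightarrow> 'a bilin_field \<Rightarrow> bool" where
  "pseudo_riemannian_metric A g \<longleftrightarrow>
     (\<forall>p. \<forall>u\<in>tangent_space A p. \<forall>v\<in>tangent_space A p. \<forall>w\<in>tangent_space A p.
        g p (u + v) w = g p u w + g p v w) \<and>
     (\<forall>p r. \<forall>v\<in>tangent_space A p. \<forall>w\<in>tangent_space A p. g p (r *\<^sub>R v) w = r * g p v w) \<and>
     (\<forall>p. \<forall>v\<in>tangent_space A p. \<forall>w\<in>tangent_space A p. g p v w = g p w v) \<and>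
     (\<forall>p. \<forall>v\<in>tangent_space A p. (\<forall>w\<in>tangent_space A p. g p v w = 0) \<longrightarrow> v = 0) \<and>
     (\<forall>p q. form_index (g p) (tangent_space A p) = form_index (g q) (tangent_space A q)) \<and>
     (\<forall>X\<in>vector_fields A. \<forall>Y\<in>vector_fields A. eval2 g X Y \<in> smooth_funs A)"

text \<open>The factor 1/2 is part of the convention for \<open>d\<eta>\<close>.\<close>

definition ext_deriv :: "'a one_form \<Rightarrow> 'a vfield \<Rightarrow> 'a vfield \<Rightarrow> 'a \<Rightarrow> real" where
  "ext_deriv \<omega> X Y p =
     (X p (eval1 \<omega> Y) - Y p (eval1 \<omega> X) - \<omega> p (lie_bracket X Y p)) / 2"

text \<open>Lie derivative of a (1,1)-tensor field, as an operator on vector fields.\<close>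

definition lie_deriv_endo :: "'a vfield \<Rightarrow> 'a endo_field \<Rightarrow> 'a vfield \<Rightarrow> 'a vfield" where
  "lie_deriv_endo V T X = lie_bracket V (app T X) - app T (lie_bracket V X)"

subsection \<open>Levi-Civita connection and curvature\<close>

definition affine_connection ::
  "('a::topological_space, 'e::euclidean_space) atlas \<Rightarrow> ('a vfield \<Rightarrow> 'a vfield \<Rightarrow> 'a vfield) \<Rightarrow> bool" where
  "affine_connection A D \<longleftrightarrow>
     (\<forall>X\<in>vector_fields A. \<forall>Y\<in>vector_fields A. D X Y \<in> vector_fields A) \<and>
     (\<forall>X\<in>vector_fields A. \<forall>Y\<in>vector_fields A. \<forall>Z\<in>vector_fields A. D (X + Y) Z = D X Z + D Y Z) \<and>
     (\<forall>f\<in>smooth_funs A. \<forall>X\<in>vector_fields A. \<forall>Y\<in>vector_fields A. D (fmult f X) Y = fmult f (D X Y)) \<and>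
     (\<forall>X\<in>vector_fields A. \<forall>Y\<in>vector_fields A. \<forall>Z\<in>vector_fields A. D X (Y + Z) = D X Y + D X Z) \<and>
     (\<forall>f\<in>smooth_funs A. \<forall>X\<in>vector_fields A. \<forall>Y\<in>vector_fields A.
        D X (fmult f Y) = fmult (\<lambda>p. X p f) Y + fmult f (D X Y))"

text \<open>\<open>D\<close> is the Levi-Civita connection of \<open>g\<close>. It is unique as a map on smooth vector fields; its
  values on other arguments are irrelevant.\<close>

definition levi_civita ::
  "('a::topological_space, 'e::euclidean_space) atlas \<Rightarrow> 'a bilin_field \<Rightarrow>
     ('a vfield \<Rightarrow> 'a vfield \<Rightarrow> 'a vfield) \<Rightarrow> bool" where
  "levi_civita A g D \<longleftrightarrow> affine_connection A D \<and>
     (\<forall>X\<in>vector_fields A. \<forall>Y\<in>vector_fields A. D X Y - D Y X = lie_bracket X Y) \<and>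
     (\<forall>X\<in>vector_fields A. \<forall>Y\<in>vector_fields A. \<forall>Z\<in>vector_fields A. \<forall>p.
        X p (eval2 g Y Z) = eval2 g (D X Y) Z p + eval2 g Y (D X Z) p)"

definition curvature ::
  "('a vfield \<Rightarrow> 'a vfield \<Rightarrow> 'a vfield) \<Rightarrow> 'a vfield \<Rightarrow> 'a vfield \<Rightarrow> 'a vfield \<Rightarrow> 'a vfield" where
  "curvature D X Y Z = D X (D Y Z) - D Y (D X Z) - D (lie_bracket X Y) Z"

subsection \<open>Paracontact metric manifolds\<close>

definition paracontact_metric_manifold ::
  "nat \<Rightarrow> ('a::{t2_space,second_countable_topology}, 'e::euclidean_space) atlas \<Rightarrow>
     'a endo_field \<Rightarrow> 'a vfield \<Rightarrow> 'a one_form \<Rightarrow> 'a bilin_field \<Rightarrow> bool" where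
  "paracontact_metric_manifold n A \<phi> \<xi> \<eta> g \<longleftrightarrow>
     smooth_manifold A \<and> DIM('e) = 2 * n + 1 \<and>
     is_endo_field A \<phi> \<and> \<xi> \<in> vector_fields A \<and> is_one_form A \<eta> \<and> pseudo_riemannian_metric A g \<and>
     (\<forall>p. \<eta> p (\<xi> p) = 1) \<and>
     (\<forall>p. \<forall>v\<in>tangent_space A p. \<phi> p (\<phi> p v) = v - \<eta> p v *\<^sub>R \<xi> p) \<and>
     (\<forall>p. dim {v \<in> tangent_space A p. \<eta> p v = 0 \<and> \<phi> p v = v} = n) \<and>
     (\<forall>p. dim {v \<in> tangent_space A p. \<eta> p v = 0 \<and> \<phi> p v = - v} = n) \<and>
     (\<forall>p. \<forall>v\<in>tangent_space A p. \<forall>w\<in>tangent_space A p.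
        g p (\<phi> p v) (\<phi> p w) = - g p v w + \<eta> p v * \<eta> p w) \<and>
     (\<forall>X\<in>vector_fields A. \<forall>Y\<in>vector_fields A. \<forall>p. ext_deriv \<eta> X Y p = eval2 g X (app \<phi> Y) p)"

definition h_tensor :: "'a endo_field \<Rightarrow> 'a vfield \<Rightarrow> 'a vfield \<Rightarrow> 'a vfield" where
  "h_tensor \<phi> \<xi> X = (1 / 2) *\<^sub>R lie_deriv_endo \<xi> \<phi> X"

definition paracontact_kmn_manifold ::
  "nat \<Rightarrow> ('a::{t2_space,second_countable_topology}, 'e::euclidean_space) atlas \<Rightarrow>
     'a endo_field \<Rightarrow> 'a vfield \<Rightarrow> 'a one_form \<Rightarrow> 'a bilin_field \<Rightarrow>
     ('a vfield \<Rightarrow> 'a vfield \<Rightarrow> 'a vfield) \<Rightarrow>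
     ('a \<Rightarrow> real) \<Rightarrow> ('a \<Rightarrow> real) \<Rightarrow> ('a \<Rightarrow> real) \<Rightarrow> bool" where
  "paracontact_kmn_manifold n A \<phi> \<xi> \<eta> g D \<kappa> \<mu> \<nu> \<longleftrightarrow>
     paracontact_metric_manifold n A \<phi> \<xi> \<eta> g \<and> levi_civita A g D \<and>
     \<kappa> \<in> smooth_funs A \<and> \<mu> \<in> smooth_funs A \<and> \<nu> \<in> smooth_funs A \<and>
     (\<forall>X\<in>vector_fields A. \<forall>Y\<in>vector_fields A.
        let h = h_tensor \<phi> \<xi> in
        curvature D X Y \<xi> =
          fmult \<kappa> (fmult (eval1 \<eta> Y) X - fmult (eval1 \<eta> X) Y) +
          fmult \<mu> (fmult (eval1 \<eta> Y) (h X) - fmult (eval1 \<eta> X) (h Y)) +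
          fmult \<nu> (fmult (eval1 \<eta> Y) (app \<phi> (h X)) - fmult (eval1 \<eta> X) (app \<phi> (h Y))))"

text \<open>The eigenspace at \<open>p\<close>, for the eigenvalue \<open>c\<close>, of a tensor field given as an operator \<open>L\<close> on
  vector fields: \<open>L X p\<close> only depends on \<open>X p\<close>, and every tangent vector at \<open>p\<close> is the value of
  some vector field.\<close>

definition eigenspace_at ::
  "('a::topological_space, 'e::euclidean_space) atlas \<Rightarrow> ('a vfield \<Rightarrow> 'a vfield) \<Rightarrow> real \<Rightarrow> 'a \<Rightarrow>
     'a tvec set" where
  "eigenspace_at A L c p = {X p | X. X \<in> vector_fields A \<and> L X p = c *\<^sub>R X p}"

text \<open>The eigenfunction \<open>c\<close> may depend on the point.\<close>

definition constant_eigen_index ::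
  "('a::topological_space, 'e::euclidean_space) atlas \<Rightarrow> 'a bilin_field \<Rightarrow>
     ('a vfield \<Rightarrow> 'a vfield) \<Rightarrow> ('a \<Rightarrow> real) \<Rightarrow> bool" where
  "constant_eigen_index A g L c \<longleftrightarrow>
     (\<exists>k. \<forall>p. form_index (g p) (eigenspace_at A L (c p) p) = k)"

end

(* With S X = D_X xi, the operator P = S + phi is symmetric and anticommutes with phi, and h = phi P.
   Let D+ and D- be the eigenbundles of phi in the kernel of eta; they are isotropic and in duality.
   Closedness of d eta and the curvature condition together with P^2 = -(1 + kappa) show that D+ and D-
   are preserved by covariant differentiation modulo xi. Since P maps each eigenbundle onto the other,
   the curvature identity R(X, Y) xi = 0 on D+ then reads X(kappa) g(Y, Z) = Y(kappa) g(X, Z) for X, Y in D+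
   and Z in D-, so kappa has no derivative along D+ once D+ has rank at least 2. The structure
   (-phi, -xi, -eta, g) with functions (kappa, mu, -nu) exchanges D+ and D-, and brackets of sections of
   D+ and D- reach xi; hence kappa is constant. The xi-direction gives xi(kappa) = -2 nu (1 + kappa), so
   nu = 0, and the second Bianchi identity applied to xi gives X(mu) = 0 along D+ in the same way. *)

theory Submission
  imports Defs
begin

subsection \<open>Smooth functions on open sets\<close>

text \<open>Splitting the bundle by phi rather than by h or phi h lets one computation cover both
  signs of 1 + kappa: what enters is that P is invertible. The relation for P^2 and the formula for
  the derivative of P along xi are two halves of one equation, the one for R(X, xi) xi, split into
  its D+ and D- components. No frames are used. Since D+ and D- are isotropic and in duality,
  pairing with D- reads off the D+ component of a field and vice versa. The tensor calculus is
  carried out in abstract modules of fields with a connection, so that passing to (-phi, -xi) is a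
  second instance of the same locale. Analysis enters in two places only: a function killed by all
  fields is constant, and every tangent vector extends to a field. The obstacle in the second is
  that tangent vectors are abstract derivations, whose space has no dimension known in advance; the
  prescribed ranks of D+ and D- bound it.\<close>

lemma Ck_on_cong:
  assumes "open S" "\<And>x. x \<in> S \<Longrightarrow> f x = h x" "Ck_on k S f"
  shows "Ck_on k S h"
  using assms(2,3)
proof (induction k arbitrary: f h)
  case 0
  then show ?case using continuous_on_cong[of S S f h] by simp
next
  case (Suc k)
  have d: "(h has_derivative frechet_derivative f (at x)) (at x)" if "x \<in> S" for x
    by (rule has_derivative_transform_within_open[of f _ x UNIV S h])
      (use \<open>open S\<close> Suc.prems that in \<open>auto simp: frechet_derivative_works\<close>)
  have 1: "frechet_derivative f (at x) = frechet_derivative h (at x)" "h differentiable (at x)" if "x \<in> S" for x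
    by (rule frechet_derivative_at[OF d[OF that]])
      (use d[OF that] in \<open>auto simp: differentiable_def\<close>)
  have "Ck_on k S (\<lambda>x. frechet_derivative h (at x) v)" for v
    by (rule Suc.IH[of "\<lambda>x. frechet_derivative f (at x) v"]) (use 1(1) Suc.prems(2) in auto)
  then show ?case using 1(2) by simp
qed

lemma Ck_on_subset: "Ck_on k S f \<Longrightarrow> T \<subseteq> S \<Longrightarrow> Ck_on k T f"
  by (induction k arbitrary: f) (auto intro: continuous_on_subset)

lemma Ck_on_SucD: "Ck_on (Suc k) S f \<Longrightarrow> Ck_on k S f"
proof (induction k arbitrary: f)
  case 0
  then show ?case
    by (auto intro!: continuous_at_imp_continuous_on differentiable_imp_continuous_within)
next
  case (Suc k)
  have "Ck_on k S (\<lambda>x. frechet_derivative f (at x) v)" for v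
    by (rule Suc.IH) (use Suc.prems in simp)
  then show ?case using Suc.prems by simp
qed

text \<open>Derivatives at a point do not depend on the surrounding set, so the neighbourhood may
  vary with the point and with \<open>k\<close>. This glues a chart formula to the zero function in
  \<open>bump_extend\<close>.\<close>

lemma Ck_on_local:
  assumes "\<And>x. x \<in> S \<Longrightarrow> \<exists>T. open T \<and> x \<in> T \<and> Ck_on k T f"
  shows "Ck_on k S f"
  using assms
proof (induction k arbitrary: f)
  case 0
  then show ?case
    by (auto intro!: continuous_at_imp_continuous_on dest!: 0 simp: continuous_on_eq_continuous_at)
next
  case (Suc k)
  have "f differentiable (at x)" if "x \<in> S" for x
    using Suc.prems[OF that] by auto
  moreover have "Ck_on k S (\<lambda>x. frechet_derivative f (at x) v)" for v
    by (rule Suc.IH) (use Suc.prems in fastforce)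
  ultimately show ?case by simp
qed

lemma Ck_on_const [simp]: "Ck_on k S (\<lambda>x. a)"
  by (induction k arbitrary: a) simp_all

lemma Ck_on_linear_compose:
  assumes L: "bounded_linear L" and "open S" "Ck_on k S f"
  shows "Ck_on k S (\<lambda>x. L (f x))"
  using assms(3)
proof (induction k arbitrary: f)
  case 0
  then show ?case using bounded_linear.continuous_on[OF L] by simp
next
  case (Suc k)
  have d: "((\<lambda>x. L (f x)) has_derivative (\<lambda>v. L (frechet_derivative f (at x) v))) (at x)" if "x \<in> S" for x
    using Suc.prems that by (intro bounded_linear.has_derivative[OF L]) (auto simp: frechet_derivative_works)
  have "Ck_on k S (\<lambda>x. frechet_derivative (\<lambda>x. L (f x)) (at x) v)" for v
    by (rule Ck_on_cong[OF \<open>open S\<close> _ Suc.IH]) (use Suc.prems frechet_derivative_at[OF d] in \<open>auto dest: fun_cong\<close>)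
  then show ?case using d by (auto simp: differentiable_def)
qed

lemma Ck_on_add:
  assumes "open S" "Ck_on k S f" "Ck_on k S h"
  shows "Ck_on k S (\<lambda>x. f x + h x)"
  using assms(2,3)
proof (induction k arbitrary: f h)
  case 0
  then show ?case by (simp add: continuous_on_add)
next
  case (Suc k)
  have d: "((\<lambda>x. f x + h x) has_derivative
      (\<lambda>v. frechet_derivative f (at x) v + frechet_derivative h (at x) v)) (at x)" if "x \<in> S" for x
    using Suc.prems that by (intro has_derivative_add) (auto simp: frechet_derivative_works)
  have "Ck_on k S (\<lambda>x. frechet_derivative (\<lambda>x. f x + h x) (at x) v)" for v
    by (rule Ck_on_cong[OF \<open>open S\<close> _ Suc.IH]) (use Suc.prems frechet_derivative_at[OF d] in \<open>auto dest: fun_cong\<close>)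
  then show ?case using d by (auto simp: differentiable_def)
qed

lemma Ck_on_sum:
  assumes "open S" "\<And>i. i \<in> I \<Longrightarrow> Ck_on k S (f i)"
  shows "Ck_on k S (\<lambda>x. \<Sum>i\<in>I. f i x)"
  using assms(2)
  by (induction I rule: infinite_finite_induct) (auto intro!: Ck_on_add[OF \<open>open S\<close>])

lemma Ck_on_mult:
  fixes f h :: "'b::real_normed_vector \<Rightarrow> real"
  assumes "open S" "Ck_on k S f" "Ck_on k S h"
  shows "Ck_on k S (\<lambda>x. f x * h x)"
  using assms(2,3)
proof (induction k arbitrary: f h)
  case 0
  then show ?case by (simp add: continuous_on_mult)
next
  case (Suc k)
  have d: "((\<lambda>x. f x * h x) has_derivative
      (\<lambda>v. f x * frechet_derivative h (at x) v + frechet_derivative f (at x) v * h x)) (at x)" if "x \<in> S" for x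
    using Suc.prems that by (intro has_derivative_mult) (auto simp: frechet_derivative_works)
  have "Ck_on k S (\<lambda>x. f x * frechet_derivative h (at x) v + frechet_derivative f (at x) v * h x)" for v
    using Suc.prems[THEN Ck_on_SucD] Suc.prems by (intro Ck_on_add[OF \<open>open S\<close>] Suc.IH) simp_all
  then have "Ck_on k S (\<lambda>x. frechet_derivative (\<lambda>x. f x * h x) (at x) v)" for v
    by (rule Ck_on_cong[OF \<open>open S\<close>, rotated]) (rule fun_cong[OF frechet_derivative_at[OF d]])
  then show ?case using d by (auto simp: differentiable_def)
qed

lemma Ck_on_compose:
  fixes f :: "'b::real_normed_vector \<Rightarrow> 'c::euclidean_space" and h :: "'c \<Rightarrow> real"
  assumes S: "open S" and T: "open T" and fST: "f ` S \<subseteq> T" and "Ck_on k S f" "Ck_on k T h"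
  shows "Ck_on k S (\<lambda>x. h (f x))"
  using assms(4,5)
proof (induction k arbitrary: h)
  case 0
  then show ?case using fST by (auto intro: continuous_on_compose2)
next
  case (Suc k)
  \<comment> \<open>\<open>Ck_on\<close> controls derivatives in fixed directions only, while the
    chain rule differentiates \<open>h\<close> in a direction that moves with \<open>x\<close>.
    Expanding that direction in the basis leaves partial derivatives of \<open>h\<close>, to which
    the induction hypothesis applies.\<close>
  let ?D = "\<lambda>x v. \<Sum>b\<in>Basis. (frechet_derivative f (at x) v \<bullet> b) * frechet_derivative h (at (f x)) b"
  have d: "((\<lambda>x. h (f x)) has_derivative ?D x) (at x)" if "x \<in> S" for x
  proof -
    have f: "(f has_derivative frechet_derivative f (at x)) (at x)"
      and h: "(h has_derivative frechet_derivative h (at (f x))) (at (f x))"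
      using Suc.prems that fST by (auto simp: frechet_derivative_works)
    interpret h: bounded_linear "frechet_derivative h (at (f x))"
      using h by (rule has_derivative_bounded_linear)
    have "?D x v = frechet_derivative h (at (f x)) (frechet_derivative f (at x) v)" for v
      by (subst (3) euclidean_representation[symmetric]) (simp add: h.sum h.scaleR)
    then show ?thesis using has_derivative_compose[OF f h] by presburger
  qed
  have "Ck_on k S (\<lambda>x. ?D x v)" for v
    using Suc.prems Suc.IH[OF Ck_on_SucD[OF Suc.prems(1)], of "\<lambda>y. frechet_derivative h (at y) _"]
    by (intro Ck_on_sum[OF S] Ck_on_mult[OF S] Ck_on_linear_compose[OF bounded_linear_inner_left S]) auto
  then have "Ck_on k S (\<lambda>x. frechet_derivative (\<lambda>x. h (f x)) (at x) v)" for v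
    by (rule Ck_on_cong[OF S, rotated]) (rule fun_cong[OF frechet_derivative_at[OF d]])
  then show ?case using d by (auto simp: differentiable_def)
qed

section \<open>Flat functions and bumps\<close>

definition flat :: "nat \<Rightarrow> real \<Rightarrow> real" where
  "flat m s = (if s > 0 then (1 / s) ^ m * exp (- 1 / s) else 0)"

lemma flat_tendsto_0: "(flat m \<longlongrightarrow> 0) (at_right 0)"
proof -
  have "((\<lambda>s::real. (inverse s) ^ m / exp (inverse s)) \<longlongrightarrow> 0) (at_right 0)"
    by (rule filterlim_compose[OF tendsto_power_div_exp_0 filterlim_inverse_at_top_right])
  moreover have "\<forall>\<^sub>F s in at_right 0. (inverse s) ^ m / exp (inverse s) = flat m s"
    by (auto simp: eventually_at_right_less flat_def exp_minus field_simps intro!: eventually_mono[OF eventually_at_right_less])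
  ultimately show ?thesis by (rule Lim_transform_eventually)
qed

text \<open>The function of interest is \<open>flat 0\<close>, that is exp(-1/s); the powers of 1/s
  are carried along because the family is then closed under differentiation, so that smoothness is a
  single induction. At 0 the right difference quotient of \<open>flat m\<close> is
  \<open>flat (Suc m)\<close>, which tends to 0.\<close>

lemma DERIV_flat: "(flat m has_real_derivative flat (m + 2) s - m * flat (m + 1) s) (at s)"
proof -
  consider "s > 0" | "s < 0" | "s = 0" by linarith
  then show ?thesis
  proof cases
    case 1
    have "((\<lambda>s. (1 / s) ^ m * exp (- 1 / s)) has_real_derivative flat (m + 2) s - m * flat (m + 1) s) (at s)"
      using 1 by (auto intro!: derivative_eq_intros simp: flat_def power2_eq_square field_simps)
        (cases m; simp add: field_simps)
    then show ?thesis
      by (rule has_field_derivative_transform_within_open[where S = "{0<..}"]) (use 1 in \<open>auto simp: flat_def\<close>)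
  next
    case 2
    have "((\<lambda>s. 0) has_real_derivative flat (m + 2) s - m * flat (m + 1) s) (at s)"
      using 2 by (simp add: flat_def)
    then show ?thesis 
      by (rule has_field_derivative_transform_within_open[where S = "{..<0}"]) (use 2 in \<open>auto simp: flat_def\<close>)
  next
    case 3
    have "((\<lambda>y. flat m y / y) \<longlongrightarrow> 0) (at_right 0)"
      by (rule Lim_transform_eventually[OF flat_tendsto_0[of "Suc m"]])
        (auto simp: flat_def intro!: eventually_mono[OF eventually_at_right_less])
    moreover have "((\<lambda>y. flat m y / y) \<longlongrightarrow> 0) (at_left 0)"
      by (rule Lim_transform_eventually[OF tendsto_const])
        (auto simp: flat_def eventually_at_filter)
    ultimately show ?thesis
      using 3 by (simp add: has_field_derivative_iff filterlim_at_split) (simp add: flat_def)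
  qed
qed

lemma Ck_on_flat: "Ck_on k UNIV (flat m)"
proof (induction k arbitrary: m)
  case 0
  then show ?case
    using DERIV_flat by (auto intro!: continuous_at_imp_continuous_on DERIV_isCont)
next
  case (Suc k)
  have d: "(flat m has_derivative (\<lambda>v. flat (m + 2) s * v + - real m * flat (m + 1) s * v)) (at s)" for s
    by (rule has_derivative_eq_rhs[OF DERIV_flat[of m s, unfolded has_field_derivative_def]])
      (simp add: fun_eq_iff algebra_simps)
  have "Ck_on k UNIV (\<lambda>s. flat (m + 2) s * v + - real m * flat (m + 1) s * v)" for v
    by (intro Ck_on_add Ck_on_mult Suc.IH Ck_on_const) auto
  then have "Ck_on k UNIV (\<lambda>x. frechet_derivative (flat m) (at x) v)" for v
    by (rule Ck_on_cong[rotated 2]) (use frechet_derivative_at[OF d] in \<open>auto dest: fun_cong\<close>)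
  then show ?case using d by (auto simp: differentiable_def)
qed

lemma smooth_on_cong: "open S \<Longrightarrow> (\<And>x. x \<in> S \<Longrightarrow> f x = h x) \<Longrightarrow> smooth_on S f \<Longrightarrow> smooth_on S h"
  unfolding smooth_on_def by (metis Ck_on_cong)

lemma smooth_on_subset: "smooth_on S f \<Longrightarrow> T \<subseteq> S \<Longrightarrow> smooth_on T f"
  unfolding smooth_on_def using Ck_on_subset by blast

lemma smooth_on_const: "smooth_on S (\<lambda>x. a)"
  by (simp add: smooth_on_def)

lemma smooth_on_add: "open S \<Longrightarrow> smooth_on S f \<Longrightarrow> smooth_on S h \<Longrightarrow> smooth_on S (\<lambda>x. f x + h x)"
  by (simp add: smooth_on_def Ck_on_add)

lemma smooth_on_mult:
  fixes f h :: "'b::real_normed_vector \<Rightarrow> real"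
  shows "open S \<Longrightarrow> smooth_on S f \<Longrightarrow> smooth_on S h \<Longrightarrow> smooth_on S (\<lambda>x. f x * h x)"
  by (simp add: smooth_on_def Ck_on_mult)

lemma smooth_on_compose:
  fixes f :: "'b::real_normed_vector \<Rightarrow> 'c::euclidean_space" and h :: "'c \<Rightarrow> real"
  shows "\<lbrakk>open S; open T; f ` S \<subseteq> T; smooth_on S f; smooth_on T h\<rbrakk> \<Longrightarrow> smooth_on S (\<lambda>x. h (f x))"
  by (simp add: smooth_on_def Ck_on_compose)

lemma smooth_on_differentiable: "smooth_on S f \<Longrightarrow> x \<in> S \<Longrightarrow> f differentiable (at x)"
  unfolding smooth_on_def by (drule spec[of _ "Suc 0"]) simp

lemma smooth_on_frechet:
  assumes "smooth_on S f"
  shows "smooth_on S (\<lambda>x. frechet_derivative f (at x) v)"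
  unfolding smooth_on_def
proof
  fix k
  have "Ck_on (Suc k) S f" using assms by (simp only: smooth_on_def)
  then show "Ck_on k S (\<lambda>x. frechet_derivative f (at x) v)" by simp
qed

lemma Ck_on_linear:
  assumes "bounded_linear L" shows "Ck_on k S L"
proof (cases k)
  case 0
  then show ?thesis using assms by (simp add: linear_continuous_on)
next
  case (Suc k)
  have d: "(L has_derivative L) (at x)" for x
    using assms by (rule bounded_linear_imp_has_derivative)
  then show ?thesis using Suc by (auto simp: frechet_derivative_at[OF d, symmetric] differentiable_def)
qed

lemma smooth_on_inner: "smooth_on S (\<lambda>x. (x - a) \<bullet> b)"
proof -
  have "Ck_on k UNIV (\<lambda>x. x \<bullet> b + - (a \<bullet> b))" for k
    by (intro Ck_on_add Ck_on_linear[OF bounded_linear_inner_left] Ck_on_const) simp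
  then have "smooth_on UNIV (\<lambda>x. (x - a) \<bullet> b)"
    by (simp add: smooth_on_def inner_diff_left)
  then show ?thesis by (rule smooth_on_subset) simp
qed

text \<open>For r > 0 this is positive exactly on the open ball about \<open>a\<close>. The squared
  distance is spelled out in coordinates so that the closure lemmas for sums and products give
  smoothness.\<close>

definition bump :: "'e::euclidean_space \<Rightarrow> real \<Rightarrow> 'e \<Rightarrow> real" where
  "bump a r x = flat 0 (r\<^sup>2 - (\<Sum>b\<in>Basis. ((x - a) \<bullet> b) * ((x - a) \<bullet> b)))"

lemma bump_norm: "bump a r x = flat 0 (r\<^sup>2 - (norm (x - a))\<^sup>2)"
  by (simp add: bump_def power2_norm_eq_inner flip: euclidean_inner[of "x - a"])

lemma bump_center: "r > 0 \<Longrightarrow> bump a r a > 0"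
  by (simp add: bump_norm flat_def)

lemma bump_outside: "r > 0 \<Longrightarrow> x \<notin> cball a r \<Longrightarrow> bump a r x = 0"
  by (auto simp: bump_norm flat_def dist_norm norm_minus_commute power_mono not_less)

lemma smooth_on_bump: "smooth_on S (bump a r)"
proof -
  have "Ck_on k UNIV (bump a r)" for k
  proof -
    have "Ck_on k UNIV (\<lambda>x. r\<^sup>2 + (-1) * (\<Sum>b\<in>Basis. ((x - a) \<bullet> b) * ((x - a) \<bullet> b)))"
      using smooth_on_inner[of UNIV a]
      by (intro Ck_on_add Ck_on_mult Ck_on_sum Ck_on_const) (auto simp: smooth_on_def)
    from Ck_on_compose[OF _ _ _ this Ck_on_flat[of k 0], simplified] show ?thesis
      by (simp add: bump_def[abs_def])
  qed
  then show ?thesis unfolding smooth_on_def by (metis Ck_on_subset subset_UNIV)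
qed

subsection \<open>Vector fields on a manifold\<close>

locale smooth_mfd =
  fixes A :: "('a::{t2_space,second_countable_topology}, 'e::euclidean_space) atlas"
  assumes mfd: "smooth_manifold A"
begin

lemma chart:
  assumes "(U, c) \<in> A"
  shows "open U" "open (c ` U)" "homeomorphism U (c ` U) c (inv_into U c)"
  using mfd assms unfolding smooth_manifold_def by blast+

lemma chart_cover: obtains U c where "(U, c) \<in> A" "p \<in> U"
  using mfd unfolding smooth_manifold_def by blast

lemma transition:
  assumes "(U, c) \<in> A" "(V, d) \<in> A"
  shows "smooth_on (c ` (U \<inter> V)) (\<lambda>x. d (inv_into U c x))"
  using mfd assms unfolding smooth_manifold_def comp_def by blast

lemma inv_chart: "(U, c) \<in> A \<Longrightarrow> q \<in> U \<Longrightarrow> inv_into U c (c q) = q"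
  using chart(3) by (rule homeomorphism_apply1)

lemma open_chart_image:
  assumes "(U, c) \<in> A" "open W"
  shows "open (c ` (U \<inter> W))"
proof -
  have "openin (top_of_set (c ` U)) (c ` (U \<inter> W))"
    using homeomorphism_imp_open_map[OF chart(3)[OF assms(1)]] assms(2) by (simp add: openin_open_Int)
  then show ?thesis using chart(2)[OF assms(1)] openin_open_trans by blast
qed

lemma smooth_funsD: "f \<in> smooth_funs A \<Longrightarrow> (U, c) \<in> A \<Longrightarrow> smooth_on (c ` U) (\<lambda>x. f (inv_into U c x))"
  unfolding smooth_funs_def comp_def by blast

lemma smooth_funsI: "(\<And>U c. (U, c) \<in> A \<Longrightarrow> smooth_on (c ` U) (\<lambda>x. f (inv_into U c x))) \<Longrightarrow> f \<in> smooth_funs A"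
  unfolding smooth_funs_def comp_def by blast

lemma smooth_funs_const: "(\<lambda>p. r) \<in> smooth_funs A"
  by (rule smooth_funsI) (rule smooth_on_const)

lemma smooth_funs_add: "f \<in> smooth_funs A \<Longrightarrow> h \<in> smooth_funs A \<Longrightarrow> (\<lambda>p. f p + h p) \<in> smooth_funs A"
  by (rule smooth_funsI, rule smooth_on_add) (auto intro: chart(2) smooth_funsD)

lemma smooth_funs_mult: "f \<in> smooth_funs A \<Longrightarrow> h \<in> smooth_funs A \<Longrightarrow> (\<lambda>p. f p * h p) \<in> smooth_funs A"
  by (rule smooth_funsI, rule smooth_on_mult) (auto intro: chart(2) smooth_funsD)

text \<open>The preimage K of the closed ball is compact, hence closed in the Hausdorff space. So U
  and the complement of K are open and cover the manifold; on the first the function has a smooth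
  chart formula, on the second it is zero.\<close>

lemma bump_extend:
  assumes Uc: "(U, c) \<in> A" and r: "r > 0" "cball a r \<subseteq> c ` U" and H: "smooth_on (c ` U) H"
  shows "(\<lambda>q. if q \<in> U then bump a r (c q) * H (c q) else 0) \<in> smooth_funs A" (is "?F \<in> _")
proof (rule smooth_funsI)
  fix V d assume Vd: "(V, d) \<in> A"
  define K where "K = inv_into U c ` cball a r"
  have "continuous_on (cball a r) (inv_into U c)"
    by (rule continuous_on_subset[OF homeomorphism_cont2[OF chart(3)[OF Uc]] r(2)])
  then have "closed K" unfolding K_def by (rule compact_imp_closed[OF compact_continuous_image[OF _ compact_cball]])
  have "K \<subseteq> U" unfolding K_def using r(2) by (auto intro: inv_into_into)
  have off_K: "?F q = 0" if "q \<notin> K" for q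
  proof (cases "q \<in> U")
    case True
    have "c q \<notin> cball a r"
    proof
      assume "c q \<in> cball a r"
      then have "q \<in> K" unfolding K_def using imageI[of "c q" _ "inv_into U c"] inv_chart[OF Uc True] by simp
      then show False using that by simp
    qed
    then show ?thesis by (simp add: bump_outside[OF r(1)] del: mem_cball)
  qed simp
  have BH: "smooth_on (c ` U) (\<lambda>x. bump a r x * H x)"
    by (rule smooth_on_mult[OF chart(2)[OF Uc] smooth_on_bump H])
  define F where "F = ?F"
  have F_U: "F q = bump a r (c q) * H (c q)" if "q \<in> U" for q
    using that by (simp add: F_def)
  have F_K: "F q = 0" if "q \<notin> K" for q
    unfolding F_def using that by (rule off_K)
  have oU: "open (d ` (V \<inter> U))" by (rule open_chart_image[OF Vd chart(1)[OF Uc]])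
  have oK: "open (d ` (V \<inter> - K))" by (rule open_chart_image[OF Vd]) (use \<open>closed K\<close> in auto)
  have "smooth_on (d ` (V \<inter> U)) (\<lambda>y. bump a r (c (inv_into V d y)) * H (c (inv_into V d y)))"
  proof (rule smooth_on_compose[OF oU chart(2)[OF Uc] _ transition[OF Vd Uc] BH])
    show "(\<lambda>y. c (inv_into V d y)) ` d ` (V \<inter> U) \<subseteq> c ` U"
      by (auto simp: inv_chart[OF Vd])
  qed
  then have FU: "smooth_on (d ` (V \<inter> U)) (\<lambda>y. F (inv_into V d y))"
    by (rule smooth_on_cong[OF oU, rotated]) (auto simp: inv_chart[OF Vd] F_U)
  have FK: "Ck_on k (d ` (V \<inter> - K)) (\<lambda>y. F (inv_into V d y))" for k
    by (rule Ck_on_cong[OF oK _ Ck_on_const[of _ _ 0]]) (auto simp: inv_chart[OF Vd] F_K)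
  have "smooth_on (d ` V) (\<lambda>y. F (inv_into V d y))"
    unfolding smooth_on_def
  proof (intro allI Ck_on_local)
    fix k y assume "y \<in> d ` V"
    then obtain q where q: "q \<in> V" "y = d q" by blast
    show "\<exists>T. open T \<and> y \<in> T \<and> Ck_on k T (\<lambda>y. F (inv_into V d y))"
    proof (cases "q \<in> U")
      case True
      then show ?thesis
        using oU FU q unfolding smooth_on_def by (intro exI[of _ "d ` (V \<inter> U)"]) simp
    next
      case False
      then have "q \<notin> K" using \<open>K \<subseteq> U\<close> by blast
      then show ?thesis using oK FK q by (intro exI[of _ "d ` (V \<inter> - K)"]) simp
    qed
  qed
  then show "smooth_on (d ` V) (\<lambda>y. ?F (inv_into V d y))"
    unfolding F_def .
qed

section \<open>Tangent vectors and the module of vector fields\<close>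

lemma tangent_add:
    "\<lbrakk>v \<in> tangent_space A p; f \<in> smooth_funs A; h \<in> smooth_funs A\<rbrakk> \<Longrightarrow> v (\<lambda>q. f q + h q) = v f + v h"
  and tangent_scale: "\<lbrakk>v \<in> tangent_space A p; f \<in> smooth_funs A\<rbrakk> \<Longrightarrow> v (\<lambda>q. r * f q) = r * v f"
  and tangent_mult:
    "\<lbrakk>v \<in> tangent_space A p; f \<in> smooth_funs A; h \<in> smooth_funs A\<rbrakk> \<Longrightarrow> v (\<lambda>q. f q * h q) = f p * v h + h p * v f"
  and tangent_nonsmooth: "\<lbrakk>v \<in> tangent_space A p; f \<notin> smooth_funs A\<rbrakk> \<Longrightarrow> v f = 0"
  by (simp_all add: tangent_space_def)

lemma tangent_const: 
  assumes "v \<in> tangent_space A p"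
  shows "v (\<lambda>q. r) = 0"
proof -
  have "v (\<lambda>q. 1) = 0"
    using tangent_mult[OF assms smooth_funs_const[of 1] smooth_funs_const[of 1]] by simp
  then show ?thesis using tangent_scale[OF assms smooth_funs_const[of 1], of r] by simp
qed

lemma smooth_funs_scale: "f \<in> smooth_funs A \<Longrightarrow> (\<lambda>p. r * f p) \<in> smooth_funs A"
  by (rule smooth_funs_mult[OF smooth_funs_const])

lemma tangent_space_plus: "v \<in> tangent_space A p \<Longrightarrow> w \<in> tangent_space A p \<Longrightarrow> v + w \<in> tangent_space A p"
  unfolding tangent_space_def by (auto simp: algebra_simps)

lemma tangent_space_scaleR: "v \<in> tangent_space A p \<Longrightarrow> r *\<^sub>R v \<in> tangent_space A p"
  unfolding tangent_space_def by (auto simp: scaleR_fun_def algebra_simps)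

lemma tangent_space_0: "0 \<in> tangent_space A p"
  unfolding tangent_space_def by auto

lemma vector_fieldsI: "(\<And>p. X p \<in> tangent_space A p) \<Longrightarrow> (\<And>f. f \<in> smooth_funs A \<Longrightarrow> (\<lambda>p. X p f) \<in> smooth_funs A) \<Longrightarrow> X \<in> vector_fields A"
  by (simp add: vector_fields_def)

lemma vector_fields_tangent: "X \<in> vector_fields A \<Longrightarrow> X p \<in> tangent_space A p"
  and vector_fields_smooth: "X \<in> vector_fields A \<Longrightarrow> f \<in> smooth_funs A \<Longrightarrow> (\<lambda>p. X p f) \<in> smooth_funs A"
  by (auto simp: vector_fields_def)

lemma vector_fields_plus: "X \<in> vector_fields A \<Longrightarrow> Y \<in> vector_fields A \<Longrightarrow> X + Y \<in> vector_fields A"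
  by (intro vector_fieldsI) (simp_all add: tangent_space_plus smooth_funs_add vector_fields_def)

lemma fmult_apply: "fmult f X p h = f p * X p h"
  by (simp add: fmult_def scaleR_fun_def)

lemma vector_fields_fmult:
  assumes "f \<in> smooth_funs A" "X \<in> vector_fields A"
  shows "fmult f X \<in> vector_fields A"
proof (rule vector_fieldsI)
  show "fmult f X p \<in> tangent_space A p" for p
    unfolding fmult_def by (rule tangent_space_scaleR) (rule vector_fields_tangent[OF assms(2)])
  show "(\<lambda>p. fmult f X p h) \<in> smooth_funs A" if "h \<in> smooth_funs A" for h
    unfolding fmult_apply by (rule smooth_funs_mult) (rule assms(1) vector_fields_smooth[OF assms(2) that])+
qed

lemma fmult_const: "fmult (\<lambda>p. r) X = r *\<^sub>R X"
  unfolding fmult_def scaleR_fun_def[of r X] ..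

lemma vector_fields_scaleR: "X \<in> vector_fields A \<Longrightarrow> r *\<^sub>R X \<in> vector_fields A"
  using vector_fields_fmult[OF smooth_funs_const] by (simp add: fmult_const)

lemma vector_fields_0: "0 \<in> vector_fields A"
  by (intro vector_fieldsI) (simp_all add: tangent_space_0 smooth_funs_const)

section \<open>Cut-off coordinate fields, extension of tangent vectors, locally constant
  functions\<close>

definition coord_field :: "'a set \<Rightarrow> ('a \<Rightarrow> 'e) \<Rightarrow> 'e \<Rightarrow> real \<Rightarrow> 'e \<Rightarrow> 'a vfield" where
  "coord_field U c a r b = (\<lambda>q f. if q \<in> U \<and> f \<in> smooth_funs A
     then bump a r (c q) * frechet_derivative (\<lambda>x. f (inv_into U c x)) (at (c q)) b else 0)"

lemma has_derivative_chart:
  assumes "(U, c) \<in> A" "q \<in> U" "f \<in> smooth_funs A"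
  shows "((\<lambda>x. f (inv_into U c x)) has_derivative frechet_derivative (\<lambda>x. f (inv_into U c x)) (at (c q))) (at (c q))"
  using smooth_on_differentiable[OF smooth_funsD[OF assms(3,1)], of "c q"] assms(2)
  by (simp add: frechet_derivative_works)

lemma coord_field_vector_field:
  assumes Uc: "(U, c) \<in> A" and r: "r > 0" "cball a r \<subseteq> c ` U"
  shows "coord_field U c a r b \<in> vector_fields A"
proof (rule vector_fieldsI)
  fix p
  show "coord_field U c a r b p \<in> tangent_space A p"
  proof (cases "p \<in> U")
    case True
    note d = has_derivative_chart[OF Uc True]
    have 1: "frechet_derivative (\<lambda>x. f (inv_into U c x) + h (inv_into U c x)) (at (c p)) b
      = frechet_derivative (\<lambda>x. f (inv_into U c x)) (at (c p)) b + frechet_derivative (\<lambda>x. h (inv_into U c x)) (at (c p)) b"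
      if "f \<in> smooth_funs A" "h \<in> smooth_funs A" for f h
      by (rule fun_cong[OF frechet_derivative_at[OF has_derivative_add[OF d[OF that(1)] d[OF that(2)]]], symmetric])
    have 2: "frechet_derivative (\<lambda>x. f (inv_into U c x) * h (inv_into U c x)) (at (c p)) b
      = f p * frechet_derivative (\<lambda>x. h (inv_into U c x)) (at (c p)) b + frechet_derivative (\<lambda>x. f (inv_into U c x)) (at (c p)) b * h p"
      if "f \<in> smooth_funs A" "h \<in> smooth_funs A" for f h
      using fun_cong[OF frechet_derivative_at[OF has_derivative_mult[OF d[OF that(1)] d[OF that(2)]]], symmetric]
      by (simp add: inv_chart[OF Uc True])
    have 3: "frechet_derivative (\<lambda>x. s * f (inv_into U c x)) (at (c p)) b
      = s * frechet_derivative (\<lambda>x. f (inv_into U c x)) (at (c p)) b" if "f \<in> smooth_funs A" for f s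
      by (rule fun_cong[OF frechet_derivative_at[OF has_derivative_mult_right[OF d[OF that]]], symmetric])
    show ?thesis
      unfolding tangent_space_def coord_field_def
      using True by (auto simp: 1 2 3 smooth_funs_add smooth_funs_mult smooth_funs_scale algebra_simps)
  next
    case False
    then have "coord_field U c a r b p = 0" by (simp add: coord_field_def fun_eq_iff)
    then show ?thesis by (simp add: tangent_space_0)
  qed
next
  fix f assume f: "f \<in> smooth_funs A"
  show "(\<lambda>p. coord_field U c a r b p f) \<in> smooth_funs A"
    using bump_extend[OF Uc r smooth_on_frechet[OF smooth_funsD[OF f Uc]], of b] f
    by (simp add: coord_field_def)
qed

definition coord_fun :: "'a set \<Rightarrow> ('a \<Rightarrow> 'e) \<Rightarrow> 'e \<Rightarrow> real \<Rightarrow> 'e \<Rightarrow> 'a \<Rightarrow> real" where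
  "coord_fun U c a r b = (\<lambda>q. if q \<in> U then bump a r (c q) * ((c q - a) \<bullet> b) else 0)"

text \<open>The coordinate is centred at \<open>c p\<close>, so the derivative of the bump is
  multiplied by zero there. The bump value survives twice, once from the field and once from the
  function.\<close>

lemma coord_field_coord_fun:
  assumes Uc: "(U, c) \<in> A" and r: "r > 0" "cball (c p) r \<subseteq> c ` U" and p: "p \<in> U"
  shows "coord_field U c (c p) r b p (coord_fun U c (c p) r b') = (bump (c p) r (c p))\<^sup>2 * (b \<bullet> b')"
proof -
  let ?a = "c p"
  have s: "coord_fun U c ?a r b' \<in> smooth_funs A"
    unfolding coord_fun_def by (rule bump_extend[OF Uc r smooth_on_inner])
  have "(bump ?a r has_derivative frechet_derivative (bump ?a r) (at ?a)) (at ?a)"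
    using smooth_on_differentiable[OF smooth_on_bump[of UNIV]] by (simp add: frechet_derivative_works)
  moreover have "((\<lambda>x. (x - ?a) \<bullet> b') has_derivative (\<lambda>v. v \<bullet> b')) (at ?a)"
    by (auto intro!: derivative_eq_intros)
  ultimately have "((\<lambda>x. bump ?a r x * ((x - ?a) \<bullet> b')) has_derivative (\<lambda>v. bump ?a r ?a * (v \<bullet> b'))) (at ?a)"
    using has_derivative_mult by fastforce
  then have "((\<lambda>x. coord_fun U c ?a r b' (inv_into U c x)) has_derivative (\<lambda>v. bump ?a r ?a * (v \<bullet> b'))) (at ?a)"
    by (rule has_derivative_transform_within_open[OF _ chart(2)[OF Uc]])
      (use p inv_chart[OF Uc] in \<open>auto simp: coord_fun_def\<close>)
  from fun_cong[OF frechet_derivative_at[OF this], symmetric] show ?thesis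
    using s p by (simp add: coord_field_def power2_eq_square)
qed

lemma sum_fun_apply: "(\<Sum>x\<in>I. f x) y = (\<Sum>x\<in>I. f x y)" for f :: "'i \<Rightarrow> 'x \<Rightarrow> 'y::comm_monoid_add"
  by (induction I rule: infinite_finite_induct) auto

text \<open>If the tangent space has dimension at most that of the model space then it is spanned by the
  coordinate derivations, so that no Taylor expansion is needed to extend tangent vectors.\<close>

lemma tangent_extend:
  assumes fin: "finite W" and card: "card W \<le> DIM('e)" and span: "tangent_space A p \<subseteq> span W"
    and v: "v \<in> tangent_space A p"
  obtains X where "X \<in> vector_fields A" "X p = v"
proof -
  obtain U c where Uc: "(U, c) \<in> A" and p: "p \<in> U" by (rule chart_cover)
  obtain r where r: "r > 0" "cball (c p) r \<subseteq> c ` U"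
    using chart(2)[OF Uc] p open_contains_cball by (metis imageI)
  let ?X = "coord_field U c (c p) r" and ?\<beta> = "(bump (c p) r (c p))\<^sup>2" and ?f = "coord_fun U c (c p) r"
  let ?E = "(\<lambda>b. ?X b p) ` Basis"
  have \<beta>: "?\<beta> > 0" using bump_center[OF r(1), of "c p"] by simp
  note X = coord_field_coord_fun[OF Uc r p]
  have inj: "inj_on (\<lambda>b. ?X b p) Basis"
  proof (rule inj_onI)
    fix b b' :: 'e assume b: "b \<in> Basis" "b' \<in> Basis" "?X b p = ?X b' p"
    then have "?\<beta> * (b \<bullet> b) = ?\<beta> * (b' \<bullet> b)" using X[of b b] X[of b' b] by simp
    then show "b = b'" using \<beta> b by (auto simp: inner_Basis split: if_splits)
  qed
  \<comment> \<open>Evaluating a vanishing combination at the coordinate function of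
    \<open>b'\<close> isolates the coefficient of the field of \<open>b'\<close>.\<close>
  have scalars_zero: "\<forall>x\<in>?E. u x = 0" if s: "(\<Sum>x\<in>?E. u x *\<^sub>R x) = 0" for u
  proof
    fix x assume "x \<in> ?E"
    then obtain b' where b': "b' \<in> Basis" "x = ?X b' p" by blast
    have 1: "(\<Sum>b\<in>Basis. u (?X b p) *\<^sub>R ?X b p) = 0"
      using s by (simp add: sum.reindex[OF inj])
    have 2: "(\<Sum>b\<in>Basis. u (?X b p) *\<^sub>R ?X b p) (?f b') = (\<Sum>b\<in>Basis. u (?X b p) * (?\<beta> * (b \<bullet> b')))"
      by (simp add: sum_fun_apply scaleR_fun_def X)
    have 3: "(\<Sum>b\<in>Basis. u (?X b p) * (?\<beta> * (b \<bullet> b'))) = (\<Sum>b\<in>Basis. if b = b' then u (?X b p) * ?\<beta> else 0)"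
      using b'(1) by (intro sum.cong) (auto simp: inner_Basis)
    have 4: "(\<Sum>b\<in>Basis. if b = b' then u (?X b p) * ?\<beta> else 0) = u x * ?\<beta>"
      using b' by simp
    have "u x * ?\<beta> = 0"
      unfolding 4[symmetric] 3[symmetric] 2[symmetric] 1 by simp
    then show "u x = 0" using \<beta> by simp
  qed
  have ind: "independent ?E"
    apply (rule real_vector.independent_if_scalars_zero)
    subgoal by simp
    subgoal for u x using scalars_zero[of u] by blast
    done
  let ?S = "(\<lambda>X. X p) ` vector_fields A"
  have "linear (\<lambda>X::'a vfield. X p)"
    by (rule linearI) (simp_all add: scaleR_fun_def[where 'b = "'a tvec"])
  then have "subspace ?S"
    by (rule linear_subspace_image)
      (simp add: subspace_def vector_fields_0 vector_fields_plus vector_fields_scaleR)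
  moreover have "?E \<subseteq> ?S"
    using coord_field_vector_field[OF Uc r] by auto
  ultimately have "span ?E \<subseteq> ?S" by (rule span_minimal[rotated])
  moreover have "v \<in> span ?E"
  \<comment> \<open>Otherwise \<open>v\<close> together with the \<open>DIM('e)\<close> independent
    coordinate derivations would be too many independent vectors in the span of
    \<open>W\<close>.\<close>
  proof (rule ccontr)
    assume nv: "v \<notin> span ?E"
    then have ind': "independent (insert v ?E)" using ind by (simp add: independent_insert)
    have nE: "v \<notin> ?E" using nv span_base[of v ?E] by fast
    have "?E \<subseteq> tangent_space A p"
      using vector_fields_tangent[OF coord_field_vector_field[OF Uc r]] by auto
    then have "insert v ?E \<subseteq> span W"
      using span v by (simp add: subset_iff)
    then have "card (insert v ?E) \<le> card W"
      using independent_span_bound[OF fin ind'] by simp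
    then show False using nE card card_image[OF inj] by simp
  qed
  ultimately have "v \<in> ?S" by (rule subsetD)
  then obtain X where "v = X p" "X \<in> vector_fields A" by (rule imageE)
  then show thesis using that[of X] by simp
qed

text \<open>A bump is positive at its own centre, so the coordinate fields centred at
  \<open>q\<close> detect every partial derivative of \<open>f\<close> at \<open>q\<close>. Hence
  \<open>f\<close> is constant on the preimage of a ball in each chart, and connectedness does the
  rest.\<close>

lemma constant_if_no_derivative:
  assumes conn: "connected (UNIV :: 'a set)" and f: "f \<in> smooth_funs A"
    and z: "\<And>X p. X \<in> vector_fields A \<Longrightarrow> X p f = 0"
  shows "\<exists>k. \<forall>p. f p = k"
proof -
  have "f constant_on UNIV"
  proof (rule locally_constant_imp_constant[OF conn])
    fix p :: 'a
    obtain U c where Uc: "(U, c) \<in> A" and p: "p \<in> U" by (rule chart_cover)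
    obtain s where s: "s > 0" "ball (c p) s \<subseteq> c ` U"
      using chart(2)[OF Uc] p open_contains_ball by (metis imageI)
    let ?F = "\<lambda>x. f (inv_into U c x)"
    have d: "(?F has_derivative (\<lambda>v. 0)) (at x)" if x: "x \<in> c ` U" for x
    proof -
      obtain q where q: "q \<in> U" "x = c q" using x by blast
      obtain r where r: "r > 0" "cball (c q) r \<subseteq> c ` U"
        using chart(2)[OF Uc] q open_contains_cball by (metis imageI)
      have "bump (c q) r (c q) * frechet_derivative ?F (at (c q)) b = 0" for b
        using z[OF coord_field_vector_field[OF Uc r, of b], of q] q f by (simp add: coord_field_def)
      then have "frechet_derivative ?F (at (c q)) = (\<lambda>b. 0)"
        using bump_center[OF r(1), of "c q"] by (intro ext) simp
      then show ?thesis using has_derivative_chart[OF Uc q(1) f] q by simp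
    qed
    obtain k where k: "\<And>x. x \<in> ball (c p) s \<Longrightarrow> ?F x = k"
      using has_derivative_zero_constant[of "ball (c p) s" ?F] d s(2) has_derivative_at_withinI
      by (metis convex_ball subsetD)
    have "open (U \<inter> c -` ball (c p) s)"
      using chart(1)[OF Uc] chart(3)[OF Uc] unfolding homeomorphism_def
      by (intro continuous_open_preimage) auto
    moreover have "f q = k" if "q \<in> U \<inter> c -` ball (c p) s" for q
      using k[of "c q"] that inv_chart[OF Uc] by auto
    moreover have "p \<in> U \<inter> c -` ball (c p) s" using p s by auto
    ultimately show "\<exists>T. openin (top_of_set UNIV) T \<and> p \<in> T \<and> (\<forall>x\<in>T. f x = f p)"
      by (metis open_openin subtopology_UNIV)
  qed
  then show ?thesis by (auto simp: constant_on_def)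
qed

section \<open>Lie brackets and the Jacobi identity\<close>

lemma tangent_diff:
  assumes "v \<in> tangent_space A p" "f \<in> smooth_funs A" "h \<in> smooth_funs A"
  shows "v (\<lambda>q. f q - h q) = v f - v h"
proof -
  have "v (\<lambda>q. f q + (-1) * h q) = v f + (-1) * v h"
    unfolding tangent_add[OF assms(1,2) smooth_funs_scale[OF assms(3)]] tangent_scale[OF assms(1,3)] ..
  then show ?thesis by simp
qed

lemma field_nonsmooth: "X \<in> vector_fields A \<Longrightarrow> f \<notin> smooth_funs A \<Longrightarrow> X p f = 0"
  by (rule tangent_nonsmooth[of "X p" p f]) (rule vector_fields_tangent)

lemma lie_bracket_apply:
  "lie_bracket X Y p f = X p (\<lambda>q. Y q f) - Y p (\<lambda>q. X q f)"
  by (simp add: lie_bracket_def)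

lemma lie_bracket_lie_bracket_apply:
  assumes X: "X \<in> vector_fields A" and Y: "Y \<in> vector_fields A" and Z: "Z \<in> vector_fields A"
    and f: "f \<in> smooth_funs A"
  shows "lie_bracket (lie_bracket X Y) Z p f = X p (\<lambda>q. Y q (\<lambda>r. Z r f)) - Y p (\<lambda>q. X q (\<lambda>r. Z r f))
    - (Z p (\<lambda>q. X q (\<lambda>r. Y r f)) - Z p (\<lambda>q. Y q (\<lambda>r. X r f)))"
proof -
  note s = vector_fields_smooth[OF X vector_fields_smooth[OF Y f]] vector_fields_smooth[OF Y vector_fields_smooth[OF X f]]
  show ?thesis
    unfolding lie_bracket_apply tangent_diff[OF vector_fields_tangent[OF Z] s] ..
qed

lemma lie_bracket_nonsmooth:
  assumes "X \<in> vector_fields A" "Y \<in> vector_fields A" "f \<notin> smooth_funs A"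
  shows "lie_bracket X Y p f = 0"
proof -
  have "(\<lambda>q. Y q f) = (\<lambda>q. 0)" "(\<lambda>q. X q f) = (\<lambda>q. 0)"
    using field_nonsmooth[OF assms(1,3)] field_nonsmooth[OF assms(2,3)] by auto
  then show ?thesis
    unfolding lie_bracket_apply
    using tangent_const[OF vector_fields_tangent[OF assms(1)]] tangent_const[OF vector_fields_tangent[OF assms(2)]]
    by simp
qed

text \<open>On smooth functions twelve third-order terms cancel in pairs. That the brackets are
  fields is used for non-smooth arguments, on which tangent vectors vanish by convention.\<close>

lemma lie_bracket_jacobi:
  assumes X: "X \<in> vector_fields A" and Y: "Y \<in> vector_fields A" and Z: "Z \<in> vector_fields A"
    and "lie_bracket X Y \<in> vector_fields A" "lie_bracket Y Z \<in> vector_fields A" "lie_bracket Z X \<in> vector_fields A"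
  shows "lie_bracket (lie_bracket X Y) Z + lie_bracket (lie_bracket Y Z) X + lie_bracket (lie_bracket Z X) Y = 0"
proof (intro ext)
  fix p f
  have "lie_bracket (lie_bracket X Y) Z p f + lie_bracket (lie_bracket Y Z) X p f + lie_bracket (lie_bracket Z X) Y p f = 0"
  proof (cases "f \<in> smooth_funs A")
    case True
    show ?thesis
      unfolding lie_bracket_lie_bracket_apply[OF X Y Z True] lie_bracket_lie_bracket_apply[OF Y Z X True]
        lie_bracket_lie_bracket_apply[OF Z X Y True] by simp
  next
    case False
    show ?thesis
      unfolding lie_bracket_nonsmooth[OF assms(4) Z False] lie_bracket_nonsmooth[OF assms(5) X False]
        lie_bracket_nonsmooth[OF assms(6) Y False] by simp
  qed
  then show "(lie_bracket (lie_bracket X Y) Z + lie_bracket (lie_bracket Y Z) X + lie_bracket (lie_bracket Z X) Y) p f = 0 p f"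
    by simp
qed

end

subsection \<open>Modules of vector fields with a Levi-Civita connection\<close>

text \<open>Torsion-freeness is built in: \<open>D X Y - D Y X\<close> plays the part of the Lie
  bracket, and \<open>act_bracket\<close> and \<open>jacobi_D\<close> are what ties it to one.
  \<open>G_nondeg\<close> is stated for fields, not at a point, so that fields can be compared by
  their pairings alone.\<close>

locale levi_civita_module =
  fixes C :: "('p \<Rightarrow> real) set" and V :: "'v::real_vector set"
    and mul :: "('p \<Rightarrow> real) \<Rightarrow> 'v \<Rightarrow> 'v"
    and act :: "'v \<Rightarrow> ('p \<Rightarrow> real) \<Rightarrow> 'p \<Rightarrow> real"
    and D :: "'v \<Rightarrow> 'v \<Rightarrow> 'v"
    and G :: "'v \<Rightarrow> 'v \<Rightarrow> 'p \<Rightarrow> real"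
  assumes C_const [simp]: "(\<lambda>p. r) \<in> C"
    and C_add [simp]: "\<lbrakk>f \<in> C; h \<in> C\<rbrakk> \<Longrightarrow> (\<lambda>p. f p + h p) \<in> C"
    and C_mult [simp]: "\<lbrakk>f \<in> C; h \<in> C\<rbrakk> \<Longrightarrow> (\<lambda>p. f p * h p) \<in> C"
    and V_add [simp]: "\<lbrakk>X \<in> V; Y \<in> V\<rbrakk> \<Longrightarrow> X + Y \<in> V"
    and V_mul [simp]: "\<lbrakk>f \<in> C; X \<in> V\<rbrakk> \<Longrightarrow> mul f X \<in> V"
    and mul_const: "X \<in> V \<Longrightarrow> mul (\<lambda>p. r) X = r *\<^sub>R X"
    and act_C [simp]: "\<lbrakk>X \<in> V; f \<in> C\<rbrakk> \<Longrightarrow> act X f \<in> C"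
    and act_const [simp]: "X \<in> V \<Longrightarrow> act X (\<lambda>p. r) p = 0"
    and act_add: "\<lbrakk>X \<in> V; f \<in> C; h \<in> C\<rbrakk> \<Longrightarrow> act X (\<lambda>p. f p + h p) p = act X f p + act X h p"
    and act_mult: "\<lbrakk>X \<in> V; f \<in> C; h \<in> C\<rbrakk> \<Longrightarrow> act X (\<lambda>p. f p * h p) p = f p * act X h p + h p * act X f p"
    and act_field_add: "\<lbrakk>X \<in> V; Y \<in> V; f \<in> C\<rbrakk> \<Longrightarrow> act (X + Y) f p = act X f p + act Y f p"
    and act_field_mul: "\<lbrakk>X \<in> V; f \<in> C; h \<in> C\<rbrakk> \<Longrightarrow> act (mul h X) f p = h p * act X f p"
    and D_V [simp]: "\<lbrakk>X \<in> V; Y \<in> V\<rbrakk> \<Longrightarrow> D X Y \<in> V"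
    and D_add_left: "\<lbrakk>X \<in> V; Y \<in> V; Z \<in> V\<rbrakk> \<Longrightarrow> D (X + Y) Z = D X Z + D Y Z"
    and D_add_right: "\<lbrakk>X \<in> V; Y \<in> V; Z \<in> V\<rbrakk> \<Longrightarrow> D X (Y + Z) = D X Y + D X Z"
    and D_mul_left: "\<lbrakk>f \<in> C; X \<in> V; Y \<in> V\<rbrakk> \<Longrightarrow> D (mul f X) Y = mul f (D X Y)"
    and D_mul_right: "\<lbrakk>f \<in> C; X \<in> V; Y \<in> V\<rbrakk> \<Longrightarrow> D X (mul f Y) = mul (act X f) Y + mul f (D X Y)"
    and G_C [simp]: "\<lbrakk>X \<in> V; Y \<in> V\<rbrakk> \<Longrightarrow> G X Y \<in> C"
    and G_sym: "\<lbrakk>X \<in> V; Y \<in> V\<rbrakk> \<Longrightarrow> G X Y p = G Y X p"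
    and G_add_left: "\<lbrakk>X \<in> V; Y \<in> V; Z \<in> V\<rbrakk> \<Longrightarrow> G (X + Y) Z p = G X Z p + G Y Z p"
    and G_mul_left: "\<lbrakk>f \<in> C; X \<in> V; Y \<in> V\<rbrakk> \<Longrightarrow> G (mul f X) Y p = f p * G X Y p"
    and G_nondeg: "\<lbrakk>X \<in> V; \<And>Y p. Y \<in> V \<Longrightarrow> G X Y p = 0\<rbrakk> \<Longrightarrow> X = 0"
    and metric_compat: "\<lbrakk>X \<in> V; Y \<in> V; Z \<in> V\<rbrakk> \<Longrightarrow> act X (G Y Z) p = G (D X Y) Z p + G Y (D X Z) p"
    and act_bracket: "\<lbrakk>X \<in> V; Y \<in> V; f \<in> C\<rbrakk> \<Longrightarrow>
      act (D X Y - D Y X) f p = act X (act Y f) p - act Y (act X f) p"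
    and jacobi_D: "\<lbrakk>X \<in> V; Y \<in> V; Z \<in> V\<rbrakk> \<Longrightarrow>
      (D (D X Y - D Y X) Z - D Z (D X Y - D Y X)) + (D (D Y Z - D Z Y) X - D X (D Y Z - D Z Y))
      + (D (D Z X - D X Z) Y - D Y (D Z X - D X Z)) = 0"
    and zero_V [simp]: "0 \<in> V"
begin

definition br :: "'v \<Rightarrow> 'v \<Rightarrow> 'v" where
  "br X Y = D X Y - D Y X"

definition curv :: "'v \<Rightarrow> 'v \<Rightarrow> 'v \<Rightarrow> 'v" where
  "curv X Y Z = D X (D Y Z) - D Y (D X Z) - D (br X Y) Z"

lemma V_scaleR [simp]: "X \<in> V \<Longrightarrow> r *\<^sub>R X \<in> V"
  using V_mul[of "\<lambda>p. r" X] by (simp add: mul_const)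

lemma V_minus [simp]: "X \<in> V \<Longrightarrow> - X \<in> V"
  using V_scaleR[of X "-1"] by simp

lemma V_diff [simp]: "\<lbrakk>X \<in> V; Y \<in> V\<rbrakk> \<Longrightarrow> X - Y \<in> V"
  using V_add[of X "- Y"] by simp

lemma C_minus [simp]: "f \<in> C \<Longrightarrow> (\<lambda>p. - f p) \<in> C"
  using C_mult[of "\<lambda>p. -1" f] by simp

lemma C_diff [simp]: "\<lbrakk>f \<in> C; h \<in> C\<rbrakk> \<Longrightarrow> (\<lambda>p. f p - h p) \<in> C"
  using C_add[of f "\<lambda>p. - h p"] by simp

lemma br_V [simp]: "\<lbrakk>X \<in> V; Y \<in> V\<rbrakk> \<Longrightarrow> br X Y \<in> V"
  by (simp add: br_def)

lemma curv_V [simp]: "\<lbrakk>X \<in> V; Y \<in> V; Z \<in> V\<rbrakk> \<Longrightarrow> curv X Y Z \<in> V"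
  by (simp add: curv_def)

lemma act_minus: "\<lbrakk>X \<in> V; f \<in> C\<rbrakk> \<Longrightarrow> act X (\<lambda>p. - f p) p = - act X f p"
  using act_mult[of X "\<lambda>p. -1" f p] by simp

lemma act_diff: "\<lbrakk>X \<in> V; f \<in> C; h \<in> C\<rbrakk> \<Longrightarrow> act X (\<lambda>p. f p - h p) p = act X f p - act X h p"
  using act_add[of X f "\<lambda>p. - h p" p] by (simp add: act_minus)

lemma act_divide: "\<lbrakk>X \<in> V; f \<in> C\<rbrakk> \<Longrightarrow> act X (\<lambda>p. f p / r) p = act X f p / r"
  using act_mult[of X "\<lambda>p. 1 / r" f p] by simp

lemma act_br: "\<lbrakk>X \<in> V; Y \<in> V; f \<in> C\<rbrakk> \<Longrightarrow> act (br X Y) f p = act X (act Y f) p - act Y (act X f) p"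
  by (simp add: br_def act_bracket)

lemma D_scaleR_left: "\<lbrakk>X \<in> V; Y \<in> V\<rbrakk> \<Longrightarrow> D (r *\<^sub>R X) Y = r *\<^sub>R D X Y"
  using D_mul_left[of "\<lambda>p. r" X Y] by (simp add: mul_const)

lemma mul_zero_fun: "X \<in> V \<Longrightarrow> (\<And>p. f p = 0) \<Longrightarrow> mul f X = 0"
  using mul_const[of X 0] by (metis ext scaleR_zero_left)

lemma D_scaleR_right: "\<lbrakk>X \<in> V; Y \<in> V\<rbrakk> \<Longrightarrow> D X (r *\<^sub>R Y) = r *\<^sub>R D X Y"
  using D_mul_right[of "\<lambda>p. r" X Y] mul_zero_fun[of Y "act X (\<lambda>p. r)"] by (simp add: mul_const)

lemma D_minus_left: "\<lbrakk>X \<in> V; Y \<in> V\<rbrakk> \<Longrightarrow> D (- X) Y = - D X Y"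
  using D_scaleR_left[of X Y "-1"] by simp

lemma D_minus_right: "\<lbrakk>X \<in> V; Y \<in> V\<rbrakk> \<Longrightarrow> D X (- Y) = - D X Y"
  using D_scaleR_right[of X Y "-1"] by simp

lemma D_diff_left: "\<lbrakk>X \<in> V; Y \<in> V; Z \<in> V\<rbrakk> \<Longrightarrow> D (X - Y) Z = D X Z - D Y Z"
  using D_add_left[of X "- Y" Z] by (simp add: D_minus_left)

lemma D_diff_right: "\<lbrakk>X \<in> V; Y \<in> V; Z \<in> V\<rbrakk> \<Longrightarrow> D X (Y - Z) = D X Y - D X Z"
  using D_add_right[of X Y "- Z"] by (simp add: D_minus_right)

lemma D_zero_left [simp]: "Y \<in> V \<Longrightarrow> D 0 Y = 0"
  using D_scaleR_left[of 0 Y 0] by simp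

lemma D_zero_right [simp]: "X \<in> V \<Longrightarrow> D X 0 = 0"
  using D_scaleR_right[of X 0 0] by simp

lemma G_scaleR_left: "\<lbrakk>X \<in> V; Y \<in> V\<rbrakk> \<Longrightarrow> G (r *\<^sub>R X) Y p = r * G X Y p"
  using G_mul_left[of "\<lambda>p. r" X Y] by (simp add: mul_const)

lemma G_minus_left: "\<lbrakk>X \<in> V; Y \<in> V\<rbrakk> \<Longrightarrow> G (- X) Y p = - G X Y p"
  using G_scaleR_left[of X Y "-1"] by simp

lemma G_diff_left: "\<lbrakk>X \<in> V; Y \<in> V; Z \<in> V\<rbrakk> \<Longrightarrow> G (X - Y) Z p = G X Z p - G Y Z p"
  using G_add_left[of X "- Y" Z] by (simp add: G_minus_left)

lemma G_zero_left [simp]: "Y \<in> V \<Longrightarrow> G 0 Y p = 0"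
  using G_scaleR_left[of 0 Y 0] by simp

lemma G_add_right: "\<lbrakk>X \<in> V; Y \<in> V; Z \<in> V\<rbrakk> \<Longrightarrow> G X (Y + Z) p = G X Y p + G X Z p"
  using G_add_left[of Y Z X p] by (simp add: G_sym[of X])

lemma G_mul_right: "\<lbrakk>f \<in> C; X \<in> V; Y \<in> V\<rbrakk> \<Longrightarrow> G X (mul f Y) p = f p * G X Y p"
  using G_mul_left[of f Y X p] by (simp add: G_sym[of X])

lemma G_scaleR_right: "\<lbrakk>X \<in> V; Y \<in> V\<rbrakk> \<Longrightarrow> G X (r *\<^sub>R Y) p = r * G X Y p"
  using G_scaleR_left[of Y X r p] by (simp add: G_sym[of X])

lemma G_minus_right: "\<lbrakk>X \<in> V; Y \<in> V\<rbrakk> \<Longrightarrow> G X (- Y) p = - G X Y p"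
  using G_minus_left[of Y X p] by (simp add: G_sym[of X])

lemma G_diff_right: "\<lbrakk>X \<in> V; Y \<in> V; Z \<in> V\<rbrakk> \<Longrightarrow> G X (Y - Z) p = G X Y p - G X Z p"
  using G_diff_left[of Y Z X p] by (simp add: G_sym[of X])

lemma G_zero_right [simp]: "X \<in> V \<Longrightarrow> G X 0 p = 0"
  using G_zero_left[of X p] by (simp add: G_sym[of X])

lemmas G_lin = G_add_left G_diff_left G_minus_left G_scaleR_left G_mul_left
  G_add_right G_diff_right G_minus_right G_scaleR_right G_mul_right

lemmas D_lin = D_add_left D_diff_left D_minus_left D_scaleR_left
  D_add_right D_diff_right D_minus_right D_scaleR_right

lemma G_eqI: "\<lbrakk>X \<in> V; Y \<in> V; \<And>Z p. Z \<in> V \<Longrightarrow> G X Z p = G Y Z p\<rbrakk> \<Longrightarrow> X = Y"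
  using G_nondeg[of "X - Y"] by (simp add: G_lin)

lemma mul_zero_right [simp]: "f \<in> C \<Longrightarrow> mul f 0 = 0"
  by (rule G_eqI) (simp_all add: G_mul_left)

lemma jacobi:
  "\<lbrakk>X \<in> V; Y \<in> V; Z \<in> V\<rbrakk> \<Longrightarrow> br (br X Y) Z + br (br Y Z) X + br (br Z X) Y = 0"
  using jacobi_D[of X Y Z] by (simp add: br_def)

section \<open>Symmetries of the curvature and the Bianchi identities\<close>

lemma curv_swap: "\<lbrakk>X \<in> V; Y \<in> V; Z \<in> V\<rbrakk> \<Longrightarrow> curv Y X Z = - curv X Y Z"
  by (simp add: curv_def br_def D_lin)

lemma curv_first_bianchi:
  assumes "X \<in> V" "Y \<in> V" "Z \<in> V"
  shows "curv X Y Z + curv Y Z X + curv Z X Y = 0"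
proof -
  have "curv X Y Z + curv Y Z X + curv Z X Y = 
    - (br (br X Y) Z + br (br Y Z) X + br (br Z X) Y)"
    using assms by (simp add: curv_def br_def D_lin)
  then show ?thesis using jacobi[OF assms] by simp
qed

text \<open>The covariant derivatives of the curvature are written out, and torsion-freeness merges
  the terms with \<open>D X Y\<close> and \<open>D Y X\<close> in a curvature slot into one with
  \<open>br X Y\<close>. After expansion only \<open>D\<close> along the Jacobi sum is left, which
  is zero.\<close>

lemma curv_second_bianchi:
  assumes "X \<in> V" "Y \<in> V" "Z \<in> V" "W \<in> V"
  shows "D X (curv Y Z W) + D Y (curv Z X W) + D Z (curv X Y W)
    = curv (br X Y) Z W + curv (br Y Z) X W + curv (br Z X) Y W
    + curv Y Z (D X W) + curv Z X (D Y W) + curv X Y (D Z W)"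
proof -
  have "D (br (br X Y) Z) W + D (br (br Y Z) X) W + D (br (br Z X) Y) W = 0"
    using arg_cong[OF jacobi[OF assms(1-3)], of "\<lambda>U. D U W"] assms by (simp add: D_lin)
  then have "D (br (br Z X) Y) W = - D (br (br X Y) Z) W - D (br (br Y Z) X) W"
    by (metis add.commute add_eq_0_iff minus_diff_commute diff_minus_eq_add minus_add_distrib)
  then show ?thesis
    using assms by (simp add: curv_def D_lin)
qed

text \<open>Differentiate \<open>G Z W\<close> twice. The mixed terms are symmetric in
  \<open>X\<close> and \<open>Y\<close>, so they cancel in the commutator, which is the action of
  \<open>br X Y\<close>.\<close>

lemma curv_skew:
  assumes [simp]: "X \<in> V" "Y \<in> V" "Z \<in> V" "W \<in> V"
  shows "G (curv X Y Z) W p = - G Z (curv X Y W) p"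
proof -
  have *: "act X' (act Y' (G Z W)) p = G (D X' (D Y' Z)) W p + G (D Y' Z) (D X' W) p
      + G (D X' Z) (D Y' W) p + G Z (D X' (D Y' W)) p" if [simp]: "X' \<in> V" "Y' \<in> V" for X' Y'
  proof -
    have "act Y' (G Z W) = (\<lambda>p. G (D Y' Z) W p + G Z (D Y' W) p)"
      by (rule ext) (simp add: metric_compat)
    then show ?thesis by (simp add: act_add metric_compat)
  qed
  have "act (br X Y) (G Z W) p = G (D (br X Y) Z) W p + G Z (D (br X Y) W) p"
    by (simp add: metric_compat)
  then show ?thesis
    by (simp add: act_br * curv_def G_lin)
qed

text \<open>The octahedron argument: four cyclic sums combined linearly, using skewness in each pair
  of arguments.\<close>

lemma curv_pair_swap:
  assumes V [simp]: "X \<in> V" "Y \<in> V" "Z \<in> V" "W \<in> V"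
  shows "G (curv X Y Z) W p = G (curv Z W X) Y p"
proof -
  have b: "G (curv X' Y' Z') W' p + G (curv Y' Z' X') W' p + G (curv Z' X' Y') W' p = 0"
    if [simp]: "X' \<in> V" "Y' \<in> V" "Z' \<in> V" "W' \<in> V" for X' Y' Z' W'
    using arg_cong[OF curv_first_bianchi[of X' Y' Z'], of "\<lambda>U. G U W' p"] by (simp add: G_lin)
  have s: "G (curv X' Y' Z') W' p = - G (curv X' Y' W') Z' p"
    if [simp]: "X' \<in> V" "Y' \<in> V" "Z' \<in> V" "W' \<in> V" for X' Y' Z' W'
    using curv_skew[of X' Y' Z' W' p] by (simp add: G_sym[of Z'])
  have t: "G (curv Y' X' Z') W' p = - G (curv X' Y' Z') W' p"
    if [simp]: "X' \<in> V" "Y' \<in> V" "Z' \<in> V" "W' \<in> V" for X' Y' Z' W'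
    by (simp add: curv_swap[of X' Y'] G_lin)
  have "G (curv X Z W) Y p = G (curv Z X Y) W p" "G (curv Y W X) Z p = G (curv W Y Z) X p"
    using s[of X Z W Y] t[of X Z Y W] s[of Y W X Z] t[of Y W Z X] by simp_all
  then show ?thesis
    using b[of X Y Z W] b[of Y Z W X] b[of Z W X Y] b[of W X Y Z]
      s[of Y Z W X] s[of Z W Y X] s[of X Y W Z] s[of W X Z Y] V by argo
qed

end

text \<open>The form eta is encoded as \<open>G X \<xi>\<close>, which compatibility of the metric
  forces, and compatibility itself appears as skewness of \<open>\<phi>\<close>. The factor 2 in
  \<open>d_eta\<close> undoes the 1/2 in the convention for d eta.\<close>

locale paracontact_module = levi_civita_module C V mul act D G
  for C :: "('p \<Rightarrow> real) set" and V :: "'v::real_vector set"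
    and mul act D G +
  fixes \<phi> :: "'v \<Rightarrow> 'v" and \<xi> :: 'v
  assumes xi_V [simp]: "\<xi> \<in> V"
    and ph_V [simp]: "X \<in> V \<Longrightarrow> \<phi> X \<in> V"
    and ph_add: "\<lbrakk>X \<in> V; Y \<in> V\<rbrakk> \<Longrightarrow> \<phi> (X + Y) = \<phi> X + \<phi> Y"
    and ph_mul: "\<lbrakk>f \<in> C; X \<in> V\<rbrakk> \<Longrightarrow> \<phi> (mul f X) = mul f (\<phi> X)"
    and G_xi_xi [simp]: "G \<xi> \<xi> p = 1"
    and ph_xi [simp]: "\<phi> \<xi> = 0"
    and ph_ph: "X \<in> V \<Longrightarrow> \<phi> (\<phi> X) = X - mul (G X \<xi>) \<xi>"
    and G_ph: "\<lbrakk>X \<in> V; Y \<in> V\<rbrakk> \<Longrightarrow> G (\<phi> X) Y p = - G X (\<phi> Y) p"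
    and d_eta: "\<lbrakk>X \<in> V; Y \<in> V\<rbrakk> \<Longrightarrow>
      act X (G Y \<xi>) p - act Y (G X \<xi>) p - G (D X Y - D Y X) \<xi> p = 2 * G X (\<phi> Y) p"
begin

section \<open>The symmetric operator P and its relations with phi and xi\<close>

definition P :: "'v \<Rightarrow> 'v" where
  "P X = D X \<xi> + \<phi> X"

definition pos :: "'v \<Rightarrow> bool" where
  "pos X \<longleftrightarrow> X \<in> V \<and> \<phi> X = X"

definition neg :: "'v \<Rightarrow> bool" where
  "neg X \<longleftrightarrow> X \<in> V \<and> \<phi> X = - X"

lemma ph_scaleR: "X \<in> V \<Longrightarrow> \<phi> (r *\<^sub>R X) = r *\<^sub>R \<phi> X"
  using ph_mul[of "\<lambda>p. r" X] by (simp add: mul_const)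

lemma ph_minus: "X \<in> V \<Longrightarrow> \<phi> (- X) = - \<phi> X"
  using ph_scaleR[of X "-1"] by simp

lemma ph_diff: "\<lbrakk>X \<in> V; Y \<in> V\<rbrakk> \<Longrightarrow> \<phi> (X - Y) = \<phi> X - \<phi> Y"
  using ph_add[of X "- Y"] by (simp add: ph_minus)

lemmas ph_lin = ph_add ph_diff ph_minus ph_scaleR ph_mul

lemma P_V [simp]: "X \<in> V \<Longrightarrow> P X \<in> V"
  by (simp add: P_def)

lemma P_add: "\<lbrakk>X \<in> V; Y \<in> V\<rbrakk> \<Longrightarrow> P (X + Y) = P X + P Y"
  by (simp add: P_def D_lin ph_lin)

lemma P_scaleR: "X \<in> V \<Longrightarrow> P (r *\<^sub>R X) = r *\<^sub>R P X"
  by (simp add: P_def D_lin ph_lin scaleR_add_right)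

lemma P_minus: "X \<in> V \<Longrightarrow> P (- X) = - P X"
  using P_scaleR[of X "-1"] by simp

lemma P_diff: "\<lbrakk>X \<in> V; Y \<in> V\<rbrakk> \<Longrightarrow> P (X - Y) = P X - P Y"
  using P_add[of X "- Y"] by (simp add: P_minus)

lemma D_xi: "D X \<xi> = P X - \<phi> X"
  by (simp add: P_def)

lemma d_eta_br: "\<lbrakk>X \<in> V; Y \<in> V\<rbrakk> \<Longrightarrow>
    act X (G Y \<xi>) p - act Y (G X \<xi>) p - G (br X Y) \<xi> p = 2 * G X (\<phi> Y) p"
  using d_eta by (simp add: br_def)

lemma G_ph_xi [simp]: "X \<in> V \<Longrightarrow> G (\<phi> X) \<xi> p = 0"
  by (simp add: G_ph)

lemma G_xi_ph [simp]: "X \<in> V \<Longrightarrow> G \<xi> (\<phi> X) p = 0"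
  by (simp add: G_sym[of \<xi>])

lemma G_D_xi_xi: "X \<in> V \<Longrightarrow> G (D X \<xi>) \<xi> p = 0"
proof -
  assume [simp]: "X \<in> V"
  have "G \<xi> \<xi> = (\<lambda>p. 1)" by (rule ext) simp
  then have "act X (G \<xi> \<xi>) p = 0" by simp
  then show ?thesis by (simp add: metric_compat G_sym[of \<xi>])
qed

lemma G_P_xi [simp]: "X \<in> V \<Longrightarrow> G (P X) \<xi> p = 0"
  by (simp add: P_def G_lin G_D_xi_xi)

lemma G_xi_P [simp]: "X \<in> V \<Longrightarrow> G \<xi> (P X) p = 0"
  by (simp add: G_sym[of \<xi>])

text \<open>By metric compatibility \<open>d_eta\<close> says that the skew part of X \<mapsto>
  \<open>D X \<xi>\<close> is -phi; adding phi leaves the symmetric part.\<close>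

lemma G_P: "\<lbrakk>X \<in> V; Y \<in> V\<rbrakk> \<Longrightarrow> G (P X) Y p = G X (P Y) p"
  using d_eta[of X Y p] G_ph[of X Y p]
  by (simp add: P_def G_lin metric_compat) (simp add: G_sym[of Y])

lemma P_xi [simp]: "P \<xi> = 0"
  by (rule G_eqI) (simp_all add: G_P)

lemma D_xi_xi [simp]: "D \<xi> \<xi> = 0"
  by (simp add: D_xi)

text \<open>This is d(d eta) = 0 in terms of the covariant derivative of phi. Expanding the
  fundamental form by \<open>d_eta_br\<close>, the second derivatives of eta cancel and the Jacobi
  identity removes the double brackets.\<close>

lemma closed_Phi:
  assumes [simp]: "X \<in> V" "Y \<in> V" "Z \<in> V"
  shows "G (D X (\<phi> Y) - \<phi> (D X Y)) Z p + G (D Y (\<phi> Z) - \<phi> (D Y Z)) X p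
    + G (D Z (\<phi> X) - \<phi> (D Z X)) Y p = 0"
proof -
  have *: "2 * act A (G B (\<phi> E)) p
      = act A (act B (G E \<xi>)) p - act A (act E (G B \<xi>)) p - act A (G (br B E) \<xi>) p"
    if [simp]: "A \<in> V" "B \<in> V" "E \<in> V" for A B E
  proof -
    have "G B (\<phi> E) = (\<lambda>p. (act B (G E \<xi>) p - act E (G B \<xi>) p - G (br B E) \<xi> p) / 2)"
      by (rule ext) (simp add: d_eta_br)
    then show ?thesis by (simp add: act_divide act_diff)
  qed
  have c: "2 * G (br A B) (\<phi> E) p
      = act A (act B (G E \<xi>)) p - act B (act A (G E \<xi>)) p - act E (G (br A B) \<xi>) p - G (br (br A B) E) \<xi> p"
    if [simp]: "A \<in> V" "B \<in> V" "E \<in> V" for A B E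
    using d_eta_br[of "br A B" E p] by (simp add: act_br)
  have j: "G (br (br X Y) Z) \<xi> p + G (br (br Y Z) X) \<xi> p + G (br (br Z X) Y) \<xi> p = 0"
    using arg_cong[OF jacobi[of X Y Z], of "\<lambda>U. G U \<xi> p"] by (simp add: G_lin)
  have d: "act A (G B (\<phi> E)) p = - G (\<phi> (D A B)) E p + G (D A (\<phi> E)) B p"
    if [simp]: "A \<in> V" "B \<in> V" "E \<in> V" for A B E
    by (simp add: metric_compat G_ph G_sym[of B])
  have e: "G (br A B) (\<phi> E) p = - G (\<phi> (D A B)) E p + G (\<phi> (D B A)) E p"
    if [simp]: "A \<in> V" "B \<in> V" "E \<in> V" for A B E
    by (simp add: br_def G_lin G_ph)
  \<comment> \<open>The covariant derivative of a skew operator is skew.\<close>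
  have f: "G (D A (\<phi> B)) E p + G (D A (\<phi> E)) B p = G (\<phi> (D A B)) E p + G (\<phi> (D A E)) B p"
    if [simp]: "A \<in> V" "B \<in> V" "E \<in> V" for A B E
  proof -
    have "G (\<phi> B) E = (\<lambda>p. - G B (\<phi> E) p)" by (rule ext) (simp add: G_ph)
    then have "act A (G (\<phi> B) E) p = - act A (G B (\<phi> E)) p" by (simp add: act_minus)
    then show ?thesis 
      using d[of A B E] metric_compat[of A "\<phi> B" E p] G_sym[of "\<phi> B" "D A E" p] G_ph[of "D A E" B p]
      by simp
  qed
  show ?thesis
    using *[of X Y Z] *[of Y Z X] *[of Z X Y] c[of X Y Z] c[of Y Z X] c[of Z X Y] j
      d[of X Y Z] d[of Y Z X] d[of Z X Y] e[of X Y Z] e[of Y Z X] e[of Z X Y]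
      f[of X Y Z] f[of Y Z X] f[of Z X Y]
    by (simp add: G_lin)
qed

text \<open>\<open>closed_Phi\<close> with \<open>\<xi>\<close> in one slot: as phi kills
  \<open>\<xi>\<close>, the other two terms involve only derivatives of \<open>\<xi>\<close>. Both
  sides turn out to be zero, which is what \<open>P_ph\<close> and \<open>D_xi_ph\<close>
  extract.\<close>

lemma nabla_xi_ph_aux:
  assumes [simp]: "X \<in> V"
  shows "D \<xi> (\<phi> X) - \<phi> (D \<xi> X) = - (\<phi> (P X) + P (\<phi> X))"
proof (rule G_eqI)
  fix Z p assume [simp]: "Z \<in> V"
  have 1: "G (D X (\<phi> Z)) \<xi> p = - G (P X) (\<phi> Z) p + G (\<phi> X) (\<phi> Z) p"
  proof -
    have "G (\<phi> Z) \<xi> = (\<lambda>p. 0)" by (rule ext) simp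
    then have "act X (G (\<phi> Z) \<xi>) p = 0" by simp
    then show ?thesis
      by (simp add: metric_compat D_xi G_lin) (simp add: G_sym[of "\<phi> Z"])
  qed
  have 2: "G (\<phi> X) (\<phi> Z) p = G (\<phi> Z) (\<phi> X) p" by (rule G_sym) simp_all
  have 3: "G (\<phi> (P Z)) X p = - G (P (\<phi> X)) Z p"
    using G_ph[of "P Z" X p] G_P[of Z "\<phi> X" p] G_sym[of Z "P (\<phi> X)" p] by simp
  have 4: "G (\<phi> (P X)) Z p = - G (P X) (\<phi> Z) p" by (simp add: G_ph)
  show "G (D \<xi> (\<phi> X) - \<phi> (D \<xi> X)) Z p = G (- (\<phi> (P X) + P (\<phi> X))) Z p"
    using closed_Phi[of \<xi> X Z p] 1 2 3 4 G_ph[of "\<phi> Z" X p]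
    by (simp add: D_xi G_lin ph_lin)
qed simp_all

lemma P_mul_xi [simp]: "f \<in> C \<Longrightarrow> P (mul f \<xi>) = 0"
  by (rule G_eqI) (simp_all add: G_P G_mul_left)

text \<open>Let N be the derivative of phi along xi. Since xi is parallel along itself,
  differentiating phi^2 = I - eta xi gives N phi + phi N = 0. Inserting N = -(phi P + P phi) yields
  phi P phi = -P, and one more phi gives the claim.\<close>

lemma P_ph: 
  assumes [simp]: "X \<in> V"
  shows "P (\<phi> X) = - \<phi> (P X)"
proof -
  have xi0: "mul (G (\<phi> Z) \<xi>) \<xi> = 0" "mul (G (P Z) \<xi>) \<xi> = 0" if "Z \<in> V" for Z
    using that by (auto intro!: mul_zero_fun)
  have pp: "\<phi> (\<phi> (D \<xi> X)) = D \<xi> X - mul (G (D \<xi> X) \<xi>) \<xi>"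
    by (simp add: ph_ph)
  have "act \<xi> (G X \<xi>) = G (D \<xi> X) \<xi>"
    by (rule ext) (simp add: metric_compat)
  then have "D \<xi> (\<phi> (\<phi> X)) = D \<xi> X - mul (G (D \<xi> X) \<xi>) \<xi>"
    by (simp add: ph_ph D_lin D_mul_right)
  moreover have "D \<xi> (\<phi> (\<phi> X)) - \<phi> (D \<xi> (\<phi> X)) = - (\<phi> (P (\<phi> X)) + P (\<phi> (\<phi> X)))"
    by (rule nabla_xi_ph_aux) simp
  moreover have "\<phi> (D \<xi> (\<phi> X)) - \<phi> (\<phi> (D \<xi> X)) = - (\<phi> (\<phi> (P X)) + \<phi> (P (\<phi> X)))"
    using arg_cong[OF nabla_xi_ph_aux[of X], of \<phi>] by (simp add: ph_lin)
  ultimately have "- (\<phi> (P (\<phi> X)) + P (\<phi> (\<phi> X))) - (\<phi> (\<phi> (P X)) + \<phi> (P (\<phi> X))) = 0"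
    using pp by (metis diff_add_cancel diff_minus_eq_add right_minus_eq uminus_add_conv_diff minus_diff_eq)
  then have "0 = \<phi> (P (\<phi> X)) + P (\<phi> (\<phi> X)) + (\<phi> (\<phi> (P X)) + \<phi> (P (\<phi> X)))"
    by (metis diff_eq_eq eq_neg_iff_add_eq_0 add.commute add_0 neg_eq_iff_add_eq_0)
  also have "\<dots> = 2 *\<^sub>R (\<phi> (P (\<phi> X)) + P X)"
    by (simp add: ph_ph xi0 P_diff scaleR_2)
  finally have "\<phi> (P (\<phi> X)) = - P X"
    by (simp add: eq_neg_iff_add_eq_0)
  from arg_cong[OF this, of \<phi>] show ?thesis
    by (simp add: ph_ph xi0 ph_minus)
qed

lemma D_xi_ph: "X \<in> V \<Longrightarrow> D \<xi> (\<phi> X) = \<phi> (D \<xi> X)"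
  using nabla_xi_ph_aux[of X] by (simp add: P_ph)

text \<open>The operator on the left is half the Lie derivative of \<open>\<phi>\<close> along \<open>\<xi>\<close>.\<close>

lemma h_eq_ph_P:
  "X \<in> V \<Longrightarrow> (1 / 2) *\<^sub>R (br \<xi> (\<phi> X) - \<phi> (br \<xi> X)) = \<phi> (P X)"
  by (simp add: br_def D_xi_ph D_xi ph_lin P_ph flip: scaleR_2)

lemma ph_ph_P: "X \<in> V \<Longrightarrow> \<phi> (\<phi> (P X)) = P X"
  by (simp add: ph_ph mul_zero_fun)

section \<open>The eigenbundles D+ and D-\<close>

lemma pos_V [simp]: "pos X \<Longrightarrow> X \<in> V" and pos_ph: "pos X \<Longrightarrow> \<phi> X = X"
  unfolding pos_def by blast+

lemma neg_V [simp]: "neg X \<Longrightarrow> X \<in> V" and neg_ph: "neg X \<Longrightarrow> \<phi> X = - X"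
  unfolding neg_def by blast+

lemma posI: "X \<in> V \<Longrightarrow> \<phi> X = X \<Longrightarrow> pos X" and negI: "X \<in> V \<Longrightarrow> \<phi> X = - X \<Longrightarrow> neg X"
  unfolding pos_def neg_def by blast+

lemma pos_P: "pos X \<Longrightarrow> neg (P X)"
  using P_ph[of X] by (metis P_V minus_minus negI pos_V pos_ph)

lemma neg_P: "neg X \<Longrightarrow> pos (P X)"
  using P_ph[of X] by (intro posI) (simp_all add: neg_ph P_minus)

lemma pos_eta [simp]: "pos X \<Longrightarrow> G X \<xi> p = 0"
  using G_ph_xi[of X p] by (simp add: pos_ph)

lemma neg_eta [simp]: "neg X \<Longrightarrow> G X \<xi> p = 0"
  using G_ph_xi[of X p] by (simp add: neg_ph G_lin)

lemma pos_eta' [simp]: "pos X \<Longrightarrow> G \<xi> X p = 0" and neg_eta' [simp]: "neg X \<Longrightarrow> G \<xi> X p = 0"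
  by (simp_all add: G_sym[of \<xi>])

lemma pos_iso: "pos X \<Longrightarrow> pos Y \<Longrightarrow> G X Y p = 0"
  using G_ph[of X Y p] by (simp add: pos_ph)

lemma neg_iso: "neg X \<Longrightarrow> neg Y \<Longrightarrow> G X Y p = 0"
  using G_ph[of X Y p] by (simp add: neg_ph G_lin)

text \<open>In \<open>closed_Phi\<close> for \<open>Z\<close>, \<open>X\<close>, \<open>Y\<close>
  the eigenvalues cancel two of the three terms and double the remaining one. Pairing with D+ sees
  the D- component, so \<open>D Z X\<close> has none.\<close>

lemma G_D_neg_pos_pos:
  assumes "neg Z" "pos X" "pos Y"
  shows "G (D Z X) Y p = 0"
proof -
  note [simp] = assms(2,3)[THEN pos_V] assms(1)[THEN neg_V]
  have "G (\<phi> (D X Y)) Z p = G (D X Y) Z p" "G (\<phi> (D Y Z)) X p = - G (D Y Z) X p"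
    "G (\<phi> (D Z X)) Y p = - G (D Z X) Y p"
    using assms by (simp_all add: G_ph pos_ph neg_ph G_minus_right)
  moreover have "D X (\<phi> Y) = D X Y" "D Y (\<phi> Z) = - D Y Z" "D Z (\<phi> X) = D Z X"
    using assms by (simp_all add: pos_ph neg_ph D_minus_right)
  ultimately show ?thesis
    using closed_Phi[of Z X Y p] by (simp add: G_diff_left G_minus_left)
qed

lemma G_D_pos_skew:
  assumes "X \<in> V" "pos Y" "pos Z"
  shows "G (D X Y) Z p = - G (D X Z) Y p"
proof -
  have "G Y Z = (\<lambda>p. 0)" using pos_iso assms by auto
  then have "act X (G Y Z) p = 0" using assms by simp
  then show ?thesis using assms by (simp add: metric_compat G_sym[of Y])
qed

lemma eta_br_pos_neg:
  assumes "pos X" "neg Y"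
  shows "G (br X Y) \<xi> p = 2 * G X Y p"
proof -
  have "G X \<xi> = (\<lambda>p. 0)" "G Y \<xi> = (\<lambda>p. 0)" using assms by auto
  then show ?thesis using d_eta_br[of X Y p] assms by (simp add: neg_ph G_lin)
qed

lemma eta_br_xi: "X \<in> V \<Longrightarrow> (\<And>p. G X \<xi> p = 0) \<Longrightarrow> G (br X \<xi>) \<xi> p = 0"
proof -
  assume [simp]: "X \<in> V" and "\<And>p. G X \<xi> p = 0"
  then have "G X \<xi> = (\<lambda>p. 0)" "G \<xi> \<xi> = (\<lambda>p. 1)" by auto
  then show ?thesis using d_eta_br[of X \<xi> p] by simp
qed

definition pos_part :: "'v \<Rightarrow> 'v" where
  "pos_part X = (1/2) *\<^sub>R (X - mul (G X \<xi>) \<xi> + \<phi> X)"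

definition neg_part :: "'v \<Rightarrow> 'v" where
  "neg_part X = (1/2) *\<^sub>R (X - mul (G X \<xi>) \<xi> - \<phi> X)"

lemma ph_mul_xi: "f \<in> C \<Longrightarrow> \<phi> (mul f \<xi>) = 0"
  by (rule G_eqI) (simp_all add: G_ph G_mul_left)

lemma pos_part_pos: "X \<in> V \<Longrightarrow> pos (pos_part X)"
  by (intro posI) (simp_all add: pos_part_def ph_lin(1-4) ph_mul_xi ph_ph algebra_simps)

lemma neg_part_neg: "X \<in> V \<Longrightarrow> neg (neg_part X)"
  by (intro negI) (simp_all add: neg_part_def ph_lin(1-4) ph_mul_xi ph_ph algebra_simps)

lemma decompose:
  assumes "X \<in> V"
  shows "X = pos_part X + neg_part X + mul (G X \<xi>) \<xi>"
proof -
  have "pos_part X + neg_part X = (1/2) *\<^sub>R (2 *\<^sub>R (X - mul (G X \<xi>) \<xi>))"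
    unfolding pos_part_def neg_part_def scaleR_add_right[symmetric] scaleR_2 by simp
  then show ?thesis by simp
qed

lemma G_eqI_pos_neg:
  assumes "X \<in> V" "Y \<in> V" "\<And>Z p. pos Z \<Longrightarrow> G X Z p = G Y Z p" "\<And>Z p. neg Z \<Longrightarrow> G X Z p = G Y Z p"
    "\<And>p. G X \<xi> p = G Y \<xi> p"
  shows "X = Y"
proof (rule G_eqI)
  fix Z p assume Z: "Z \<in> V"
  have [simp]: "pos_part Z \<in> V" "neg_part Z \<in> V" "mul (G Z \<xi>) \<xi> \<in> V"
    using pos_part_pos[OF Z] neg_part_neg[OF Z] Z by auto
  have "G W Z p = G W (pos_part Z) p + G W (neg_part Z) p + G Z \<xi> p * G W \<xi> p" if "W \<in> V" for W
    using arg_cong[OF decompose[OF Z], of "\<lambda>U. G W U p"] that Z by (simp add: G_lin)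
  then show "G X Z p = G Y Z p"
    using assms(1,2) assms(3)[OF pos_part_pos[OF Z]] assms(4)[OF neg_part_neg[OF Z]] assms(5) by simp
qed (use assms in auto)

text \<open>The sign of xi must change along with that of phi: then both sides of
  \<open>d_eta\<close> change sign. Each later statement on D+ gets its twin on D- from this
  instance.\<close>

lemma dual: "paracontact_module C V mul act D G (\<lambda>X. - \<phi> X) (- \<xi>)"
proof unfold_locales
  fix X Y p assume [simp]: "X \<in> V" "Y \<in> V"
  show "act X (G Y (- \<xi>)) p - act Y (G X (- \<xi>)) p - G (D X Y - D Y X) (- \<xi>) p = 2 * G X (- \<phi> Y) p"
  proof -
    have "G Z (- \<xi>) = (\<lambda>p. - G Z \<xi> p)" if "Z \<in> V" for Z using that by (auto simp: G_lin)
    then show ?thesis using d_eta[of X Y p] by (simp add: act_minus G_lin)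
  qed
next
  fix X assume [simp]: "X \<in> V"
  show "- \<phi> (- \<phi> X) = X - mul (G X (- \<xi>)) (- \<xi>)"
    by (rule G_eqI) (simp_all add: ph_lin ph_ph G_lin)
next
  fix f X assume "f \<in> C" and [simp]: "X \<in> V"
  then show "- \<phi> (mul f X) = mul f (- \<phi> X)"
    by (intro G_eqI) (simp_all add: ph_lin G_lin)
qed (simp_all add: ph_add ph_minus G_minus_left G_minus_right G_ph)

lemma dual_pos: "paracontact_module.pos V (\<lambda>X. - \<phi> X) X \<longleftrightarrow> neg X"
  unfolding paracontact_module.pos_def[OF dual] neg_def by (metis minus_minus)

lemma dual_neg: "paracontact_module.neg V (\<lambda>X. - \<phi> X) X \<longleftrightarrow> pos X"
  unfolding paracontact_module.neg_def[OF dual] pos_def by simp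

lemma dual_P: "X \<in> V \<Longrightarrow> paracontact_module.P D (\<lambda>X. - \<phi> X) (- \<xi>) X = - P X"
  unfolding paracontact_module.P_def[OF dual] P_def by (simp add: D_minus_right)

lemma G_D_pos_neg_neg: "pos Z \<Longrightarrow> neg X \<Longrightarrow> neg Y \<Longrightarrow> G (D Z X) Y p = 0"
  using paracontact_module.G_D_neg_pos_pos[OF dual] by (simp add: dual_pos dual_neg)

text \<open>The covariant derivative of a symmetric operator is symmetric: the left side is the
  derivative of P along \<open>X\<close>, applied to \<open>Y\<close> and paired with
  \<open>W\<close>. The same expression stands for this derivative in the lemmas below.\<close>

lemma G_D_P_swap:
  assumes "X \<in> V" "Y \<in> V" "W \<in> V"
  shows "G (D X (P Y)) W p - G (D X Y) (P W) p = G (D X (P W)) Y p - G (D X W) (P Y) p"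
proof -
  have "G (P Y) W = G Y (P W)" using assms by (auto simp: G_P)
  then have "act X (G (P Y) W) p = act X (G Y (P W)) p" by simp
  then show ?thesis
    using assms G_sym[of "P Y" "D X W" p] G_sym[of Y "D X (P W)" p] by (simp add: metric_compat)
qed

lemma curv_xi_expand:
  assumes "X \<in> V" "Y \<in> V"
  shows "curv X Y \<xi> = D X (P Y - \<phi> Y) - D Y (P X - \<phi> X) - (P (br X Y) - \<phi> (br X Y))"
  by (simp add: curv_def D_xi)

text \<open>Brackets of sections of \<open>ker \<eta>\<close> reach \<open>\<xi>\<close>, since \<open>\<eta> [X, Y] = 2 g(X, Y)\<close> for
  \<open>X\<close>, \<open>Y\<close> of opposite type.\<close>

lemma act_eq_0_if_horizontal:
  assumes f: "f \<in> C" and pos: "\<And>X p. pos X \<Longrightarrow> act X f p = 0" and neg: "\<And>X p. neg X \<Longrightarrow> act X f p = 0"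
    and ne: "\<And>p. \<exists>X Y. pos X \<and> neg Y \<and> G X Y p \<noteq> 0"
    and X: "X \<in> V"
  shows "act X f p = 0"
proof -
  have split: "act Z f p = G Z \<xi> p * act \<xi> f p" if Z: "Z \<in> V" for Z
    using arg_cong[OF decompose[OF Z], of "\<lambda>U. act U f p"] Z f
      pos_part_pos[OF Z] neg_part_neg[OF Z] pos[of "pos_part Z" p] neg[of "neg_part Z" p]
    by (simp add: act_field_add act_field_mul)
  obtain Y Z where YZ: "pos Y" "neg Z" "G Y Z p \<noteq> 0" using ne by blast
  have "act Y f = (\<lambda>p. 0)" "act Z f = (\<lambda>p. 0)" using pos neg YZ by auto
  then have "act (br Y Z) f p = 0" using YZ f by (simp add: act_br)
  then have "2 * G Y Z p * act \<xi> f p = 0"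
    using split[of "br Y Z"] YZ by (simp add: eta_br_pos_neg)
  then show ?thesis using split[OF X] YZ by simp
qed

lemma G_pos_eq_0:
  assumes X: "pos X" and Z: "\<And>Z. neg Z \<Longrightarrow> G X Z p = 0" and W: "W \<in> V"
  shows "G X W p = 0"
  using arg_cong[OF decompose[OF W], of "\<lambda>U. G X U p"] X W Z[OF neg_part_neg[OF W]]
    pos_iso[OF X pos_part_pos[OF W], of p] pos_part_pos[OF W] neg_part_neg[OF W]
  by (simp add: G_add_right G_mul_right)

text \<open>Linear algebra at the point \<open>p\<close>: nested kernels make two functionals on D-
  proportional, and the duality of D+ and D- carries this over to \<open>X\<close> and
  \<open>Y\<close>. It turns "rank at least 2" into the pairing form of
  \<open>rank_pos\<close>.\<close>

lemma pos_proportional: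
  assumes X: "pos X" and Y: "pos Y" and ker: "\<And>Z. neg Z \<Longrightarrow> G X Z p = 0 \<Longrightarrow> G Y Z p = 0"
  shows "\<exists>c. \<forall>W\<in>V. G (Y - c *\<^sub>R X) W p = 0"
proof -
  note [simp] = X[THEN pos_V] Y[THEN pos_V]
  obtain c where c: "G Y Z p = c * G X Z p" if "neg Z" for Z
  proof (cases "\<exists>Z. neg Z \<and> G X Z p \<noteq> 0")
    case False
    then show thesis using ker that[of 0] by simp
  next
    case True
    then obtain Z1 where Z1: "neg Z1" "G X Z1 p \<noteq> 0" by blast
    note [simp] = Z1(1)[THEN neg_V]
    show thesis
    proof (rule that)
      fix Z assume Z: "neg Z"
      note [simp] = Z[THEN neg_V]
      \<comment> \<open>The multiple of \<open>Z1\<close> is chosen so that the difference pairs to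
        zero with \<open>X\<close> at \<open>p\<close>.\<close>
      let ?Z' = "Z - (G X Z p / G X Z1 p) *\<^sub>R Z1"
      have "neg ?Z'" using neg_ph[OF Z] neg_ph[OF Z1(1)] by (intro negI) (simp_all add: ph_diff ph_scaleR)
      moreover have "G X ?Z' p = 0" using Z1 by (simp add: G_diff_right G_scaleR_right)
      ultimately have "G Y ?Z' p = 0" by (rule ker)
      then show "G Y Z p = (G Y Z1 p / G X Z1 p) * G X Z p"
        by (simp add: G_diff_right G_scaleR_right)
    qed
  qed
  have "pos (Y - c *\<^sub>R X)"
    using pos_ph[OF X] pos_ph[OF Y] by (intro posI) (simp_all add: ph_diff ph_scaleR)
  moreover have "G (Y - c *\<^sub>R X) Z p = 0" if "neg Z" for Z
    using c[OF that] that by (simp add: G_diff_left G_scaleR_left)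
  ultimately have "\<forall>W\<in>V. G (Y - c *\<^sub>R X) W p = 0"
    using G_pos_eq_0 by blast
  then show ?thesis ..
qed

lemma neg_proportional:
  assumes "neg X" "neg Y" "\<And>Z. pos Z \<Longrightarrow> G X Z p = 0 \<Longrightarrow> G Y Z p = 0"
  shows "\<exists>c. \<forall>W\<in>V. G (Y - c *\<^sub>R X) W p = 0"
  using paracontact_module.pos_proportional[OF dual, of X Y p] assms by (simp add: dual_pos dual_neg)

end

section \<open>The curvature condition: derivatives of kappa and mu, vanishing of nu\<close>

text \<open>\<open>G (\<phi> (P X))\<close> and \<open>G (P X)\<close> stand for \<open>h X\<close> and \<open>\<phi> (h X)\<close>, see \<open>h_eq_ph_P\<close> and \<open>ph_ph_P\<close>. The two rank
  assumptions say that \<open>D\<^sup>+\<close> and \<open>D\<^sup>-\<close> have dimension at least 2 everywhere.\<close>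

locale kmn_module = paracontact_module C V mul act D G \<phi> \<xi>
  for C :: "('p \<Rightarrow> real) set" and V :: "'v::real_vector set"
    and mul act D G \<phi> \<xi> +
  fixes k m nu :: "'p \<Rightarrow> real"
  assumes k_C [simp]: "k \<in> C" and m_C [simp]: "m \<in> C" and nu_C [simp]: "nu \<in> C"
    and k_ne: "k p \<noteq> -1"
    and curv_xi: "\<lbrakk>X \<in> V; Y \<in> V; Z \<in> V\<rbrakk> \<Longrightarrow> G (curv X Y \<xi>) Z p =
      G Y \<xi> p * (k p * G X Z p + m p * G (\<phi> (P X)) Z p + nu p * G (P X) Z p)
      - G X \<xi> p * (k p * G Y Z p + m p * G (\<phi> (P Y)) Z p + nu p * G (P Y) Z p)"
    and rank_pos: "pos X \<Longrightarrow> \<exists>Y Z. pos Y \<and> neg Z \<and> G Y Z p \<noteq> 0 \<and> G X Z p = 0"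
    and rank_neg: "neg X \<Longrightarrow> \<exists>Y Z. neg Y \<and> pos Z \<and> G Y Z p \<noteq> 0 \<and> G X Z p = 0"
begin

text \<open>P becomes -P, so h = phi P is unchanged while phi h = P changes sign. The sign of eta
  matches that of xi in the curvature; hence only \<open>nu\<close> flips.\<close>

lemma dual_kmn: "kmn_module C V mul act D G (\<lambda>X. - \<phi> X) (- \<xi>) k m (\<lambda>p. - nu p)"
proof -
  interpret d: paracontact_module C V mul act D G "\<lambda>X. - \<phi> X" "- \<xi>" by (rule dual)
  show ?thesis
  proof unfold_locales
    fix X Y Z p assume [simp]: "X \<in> V" "Y \<in> V" "Z \<in> V"
    have "curv X Y (- \<xi>) = - curv X Y \<xi>" by (simp add: curv_def D_minus_right)
    then show "G (curv X Y (- \<xi>)) Z p =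
      G Y (- \<xi>) p * (k p * G X Z p + m p * G (- \<phi> (d.P X)) Z p + - nu p * G (d.P X) Z p)
      - G X (- \<xi>) p * (k p * G Y Z p + m p * G (- \<phi> (d.P Y)) Z p + - nu p * G (d.P Y) Z p)"
      by (simp add: curv_xi dual_P ph_minus G_minus_left G_minus_right)
  qed (use rank_pos rank_neg in \<open>auto simp: k_ne dual_pos dual_neg\<close>)
qed

lemma one_plus_k_ne: "1 + k p \<noteq> 0"
  using k_ne[of p] by linarith

lemma curv_pos_xi_xi:
  assumes "pos X"
  shows "curv X \<xi> \<xi> = P (D \<xi> X) - D \<xi> (P X) - P (P X) - X"
proof -
  have "\<phi> (D \<xi> X) = D \<xi> X" using assms D_xi_ph[of X] by (simp add: pos_ph)
  moreover have "\<phi> (P X) = - P X" using pos_P[OF assms] by (simp add: neg_ph)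
  ultimately show ?thesis using assms pos_ph[OF assms]
    by (simp add: curv_xi_expand br_def D_xi[of X] D_lin P_diff ph_lin)
qed

lemma pos_D_xi: "pos X \<Longrightarrow> pos (D \<xi> X)"
  using D_xi_ph[of X] pos_ph[of X] by (intro posI) simp_all

lemma neg_D_xi: "neg X \<Longrightarrow> neg (D \<xi> X)"
  using D_xi_ph[of X] neg_ph[of X] by (intro negI) (simp_all add: D_minus_right)

text \<open>The D+ component of the equation for \<open>curv X \<xi> \<xi>\<close>, where
  \<open>D \<xi> (P X)\<close> and \<open>P (D \<xi> X)\<close> lie in D- and drop out.\<close>

lemma P_P_pos:
  assumes "pos X"
  shows "P (P X) = - X - mul k X"
proof (rule G_eqI_pos_neg)
  have n: "neg (P X)" "neg (P (D \<xi> X))" "neg (D \<xi> (P X))" "pos (P (P X))"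
    using assms pos_P neg_P pos_D_xi neg_D_xi by auto
  note [simp] = n(4)[THEN pos_V] n(2,3)[THEN neg_V]
  show "P (P X) \<in> V" "- X - mul k X \<in> V" using assms by auto
  fix Z p
  show "G (P (P X)) \<xi> p = G (- X - mul k X) \<xi> p" using assms by (simp add: G_lin)
  { assume Z: "pos Z"
    then show "G (P (P X)) Z p = G (- X - mul k X) Z p"
      using assms n pos_iso by (simp add: G_lin) }
  { assume Z: "neg Z"
    have "G (curv X \<xi> \<xi>) Z p = k p * G X Z p"
      using assms Z n by (simp add: curv_xi neg_ph G_minus_left neg_iso)
    moreover have "G (curv X \<xi> \<xi>) Z p = - G (P (P X)) Z p - G X Z p"
      using assms Z n by (simp add: curv_pos_xi_xi G_diff_left neg_iso)
    ultimately show "G (P (P X)) Z p = G (- X - mul k X) Z p"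
      using assms Z by (simp add: G_lin) }
qed

lemma P_P_neg: "neg X \<Longrightarrow> P (P X) = - X - mul k X"
  using kmn_module.P_P_pos[OF dual_kmn, of X] by (simp add: dual_pos dual_P P_minus)

lemma G_P_P_pos: "pos X \<Longrightarrow> W \<in> V \<Longrightarrow> G W (P (P X)) p = - ((1 + k p) * G W X p)"
  by (simp add: P_P_pos G_lin algebra_simps)

lemma G_P_P_neg: "neg X \<Longrightarrow> W \<in> V \<Longrightarrow> G W (P (P X)) p = - ((1 + k p) * G W X p)"
  by (simp add: P_P_neg G_lin algebra_simps)

text \<open>The D- component of the same equation. As phi is -1 on \<open>P X\<close>, the functions
  \<open>m\<close> and \<open>nu\<close> enter with opposite signs.\<close>

lemma nabla_xi_P_pos:
  assumes "pos X" "pos W"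
  shows "G (D \<xi> (P X)) W p - G (D \<xi> X) (P W) p = (m p - nu p) * G (P X) W p"
proof -
  have n: "neg (P X)" "neg (P (D \<xi> X))" "neg (D \<xi> (P X))" "pos (P (P X))"
    using assms pos_P neg_P pos_D_xi neg_D_xi by auto
  have "G (curv X \<xi> \<xi>) W p = (nu p - m p) * G (P X) W p"
    using assms n by (simp add: curv_xi neg_ph G_minus_left pos_iso algebra_simps)
  moreover have "G (curv X \<xi> \<xi>) W p = G (P (D \<xi> X)) W p - G (D \<xi> (P X)) W p"
    using assms n by (simp add: curv_pos_xi_xi G_diff_left pos_iso)
  ultimately show ?thesis using assms by (simp add: G_P algebra_simps)
qed

lemma nabla_xi_P_neg:
  assumes "neg X" "neg W"
  shows "G (D \<xi> (P X)) W p - G (D \<xi> X) (P W) p = (m p + nu p) * - G (P X) W p"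
  using kmn_module.nabla_xi_P_pos[OF dual_kmn, of X W p] assms
  by (simp add: dual_pos dual_P D_lin G_lin)

text \<open>Differentiate \<open>G (P X) (P Z)\<close> = -(1 + k) \<open>G X Z\<close> along xi. The
  derivative of P is (m - nu) P on D+ and -(m + nu) P on D-, so m cancels and -2 nu is left.\<close>

lemma act_xi_k: "act \<xi> k p = - 2 * nu p * (1 + k p)"
proof -
  \<comment> \<open>\<open>rank_pos\<close> at the zero section merely supplies a pair with nonzero
    pairing.\<close>
  have "pos 0" by (intro posI) (use ph_xi ph_scaleR[of \<xi> 0] in auto)
  then obtain X Z where XZ: "pos X" "neg Z" "G X Z p \<noteq> 0" using rank_pos[of 0 p] by blast
  note [simp] = XZ(1)[THEN pos_V] XZ(2)[THEN neg_V]
  have n: "neg (P X)" "pos (P Z)" using XZ pos_P neg_P by auto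
  have "G (P X) (P Z) = (\<lambda>p. - ((1 + k p) * G X Z p))"
    by (rule ext) (use XZ in \<open>simp add: G_P G_P_P_neg\<close>)
  then have "act \<xi> (G (P X) (P Z)) p = - (act \<xi> k p * G X Z p + (1 + k p) * (G (D \<xi> X) Z p + G (D \<xi> Z) X p))"
    using G_sym[of X "D \<xi> Z" p]
    by (simp add: act_minus act_mult act_add metric_compat)
  moreover have "act \<xi> (G (P X) (P Z)) p = G (D \<xi> (P X)) (P Z) p + G (D \<xi> (P Z)) (P X) p"
    by (simp add: metric_compat G_sym[of "P X"])
  moreover have "G (D \<xi> (P X)) (P Z) p + (1 + k p) * G (D \<xi> X) Z p = (m p - nu p) * G (P X) (P Z) p"
    using nabla_xi_P_pos[OF XZ(1) n(2)] XZ by (simp add: G_P_P_neg)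
  moreover have "G (D \<xi> (P Z)) (P X) p + (1 + k p) * G (D \<xi> Z) X p = (m p + nu p) * - G (P X) (P Z) p"
    using nabla_xi_P_neg[OF XZ(2) n(1)] XZ G_sym[of "P X" "P Z" p] by (simp add: G_P_P_pos)
  moreover have "G (P X) (P Z) p = - ((1 + k p) * G X Z p)"
    using XZ by (simp add: G_P G_P_P_neg)
  ultimately have "act \<xi> k p * G X Z p = - 2 * nu p * (1 + k p) * G X Z p"
    by algebra
  then show ?thesis using XZ(3) by (metis mult_right_cancel)
qed

text \<open>The expression is symmetric in \<open>X\<close>, \<open>Y\<close> and, D+ being
  isotropic, skew in \<open>Y\<close>, \<open>W\<close>; a trilinear form with both symmetries
  vanishes.\<close>

lemma D_pos_isotropic:
  assumes X: "pos X" and Y: "pos Y" and W: "pos W"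
  shows "G (D X Y) W p = 0"
proof -
  \<comment> \<open>Testing the vanishing \<open>curv A B \<xi>\<close> against \<open>P E\<close>
    leaves \<open>G (br A B) (P (P E))\<close>, and 1 + k is nonzero, so the bracket has no D-
    component.\<close>
  have sym: "G (D A B) E p = G (D B A) E p" if A: "pos A" and B: "pos B" and E: "pos E" for A B E
  proof -
    have n: "neg (P A)" "neg (P B)" "neg (P E)" using A B E pos_P by auto
    note [simp] = A[THEN pos_V] B[THEN pos_V] E[THEN pos_V]
    have "G (curv A B \<xi>) (P E) p = 0"
      using A B by (simp add: curv_xi)
    moreover have "G (D A (P B)) (P E) p = 0" "G (D B (P A)) (P E) p = 0"
      using A B n G_D_pos_neg_neg by auto
    moreover have "G (\<phi> (br A B)) (P E) p = G (br A B) (P E) p"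
      using n by (simp add: G_ph neg_ph G_minus_right)
    ultimately have "G (P (br A B)) (P E) p = 0"
      using pos_ph[OF A] pos_ph[OF B] 
      by (simp add: curv_xi_expand D_lin G_lin) (simp add: br_def G_lin)
    then have "(1 + k p) * G (br A B) E p = 0"
      using E by (simp add: G_P G_P_P_pos del: mult_eq_0_iff)
    then show ?thesis using one_plus_k_ne[of p] by (simp add: br_def G_lin)
  qed
  have skew: "G (D A B) E p = - G (D A E) B p" if "pos A" "pos B" "pos E" for A B E
    by (rule G_D_pos_skew) (use that in simp_all)
  show ?thesis
    using skew[OF X Y W] sym[OF X W Y] skew[OF W X Y] sym[OF W Y X] skew[OF Y W X] sym[OF Y X W]
    by linarith
qed

lemma D_neg_isotropic: "neg X \<Longrightarrow> neg Y \<Longrightarrow> neg W \<Longrightarrow> G (D X Y) W p = 0"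
  using kmn_module.D_pos_isotropic[OF dual_kmn] by (simp add: dual_pos)

text \<open>A Codazzi equation for P, from \<open>curv X Y \<xi>\<close> = 0 on D+; the phi terms
  disappear by \<open>D_pos_isotropic\<close>.\<close>

lemma D_P_sym:
  assumes X: "pos X" and Y: "pos Y" and W: "pos W"
  shows "G (D X (P Y)) W p - G (D X Y) (P W) p = G (D Y (P X)) W p - G (D Y X) (P W) p"
proof -
  note [simp] = X[THEN pos_V] Y[THEN pos_V] W[THEN pos_V]
  have "G (curv X Y \<xi>) W p = 0" using X Y by (simp add: curv_xi)
  then show ?thesis
    using D_pos_isotropic[OF X Y W] D_pos_isotropic[OF Y X W] pos_ph[OF X] pos_ph[OF Y] pos_ph[OF W]
    by (simp add: curv_xi_expand D_lin G_lin G_ph G_P) (simp add: br_def G_lin)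
qed

text \<open>The Codazzi equation for a mixed pair. Paired with D-, the terms from
  \<open>D Z (P X)\<close> and \<open>D Z X\<close> vanish, so the derivative of P along
  \<open>X\<close> sends \<open>Z\<close> to a field without D+ component.\<close>

lemma D_P_mixed:
  assumes X: "pos X" and Z: "neg Z" and Y: "neg Y"
  shows "G (D X (P Z)) Y p = G (D X Z) (P Y) p"
    and "G (br X Z) (P Y) p = G (D X Z) (P Y) p"
proof -
  note [simp] = X[THEN pos_V] Y[THEN neg_V] Z[THEN neg_V]
  have n: "neg (P X)" "pos (P Z)" "pos (P Y)" using X Y Z pos_P neg_P by auto
  show b: "G (br X Z) (P Y) p = G (D X Z) (P Y) p"
    using G_D_neg_pos_pos[OF Z X n(3)] by (simp add: br_def G_lin)
  have "G (curv X Z \<xi>) Y p = 0" using X Z by (simp add: curv_xi)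
  then show "G (D X (P Z)) Y p = G (D X Z) (P Y) p"
    using b D_neg_isotropic[OF Z n(1) Y] G_D_pos_neg_neg[OF X Z Y] pos_ph[OF X] neg_ph[OF Y] neg_ph[OF Z]
    by (simp add: curv_xi_expand D_lin G_lin G_ph G_P) (simp add: br_def G_lin)
qed

text \<open>By \<open>U\<close>, the derivative of P along \<open>A\<close>, applied to
  \<open>B\<close> and paired with \<open>P Z\<close>, is -A(k) g(B, Z): by symmetry it may be
  applied to \<open>P Z\<close> instead, and in the derivative of \<open>P (P Z)\<close> = -(1 + k)
  \<open>Z\<close> the \<open>D_P_mixed\<close> relation cancels all but the term with A(k).
  \<open>D_P_sym\<close> makes the result symmetric in \<open>X\<close> and
  \<open>Y\<close>.\<close>

lemma act_k_exchange:
  assumes X: "pos X" and Y: "pos Y" and Z: "neg Z"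
  shows "act X k p * G Y Z p = act Y k p * G X Z p"
proof -
  have U: "G (D A (P B)) (P Z) p - G (D A B) (P (P Z)) p = - act A k p * G B Z p"
    if A: "pos A" and B: "pos B" for A B
  proof -
    note [simp] = A[THEN pos_V] B[THEN pos_V] Z[THEN neg_V]
    have "G (D A (P (P Z))) B p = - G (D A Z) B p - act A k p * G Z B p - k p * G (D A Z) B p"
      using Z by (simp add: P_P_neg D_lin D_mul_right G_lin)
    moreover have "G (D A (P Z)) (P B) p = - ((1 + k p) * G (D A Z) B p)"
      using D_P_mixed(1)[OF A Z pos_P[OF B]] B by (simp add: G_P_P_pos)
    ultimately show ?thesis
      using G_D_P_swap[of A B "P Z" p] by (simp add: G_sym[of Z] algebra_simps)
  qed
  show ?thesis
    using D_P_sym[OF X Y neg_P[OF Z], of p] U[OF X Y] U[OF Y X] by simp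
qed

text \<open>\<open>rank_pos\<close> yields \<open>Z\<close> orthogonal to \<open>X\<close> but not
  to \<open>Y\<close>, so only \<open>act X k\<close> survives in the exchange.\<close>

lemma act_pos_k: "pos X \<Longrightarrow> act X k p = 0"
  using rank_pos[of X p] act_k_exchange[of X] by (metis mult_eq_0_iff)

lemma act_neg_k: "neg X \<Longrightarrow> act X k p = 0"
  using kmn_module.act_pos_k[OF dual_kmn] by (simp add: dual_pos)

lemma pos_zero: "pos 0"
  by (intro posI) (use ph_scaleR[of \<xi> 0] in simp_all)

lemma pos_neg_pairing: "\<exists>X Y. pos X \<and> neg Y \<and> G X Y p \<noteq> 0"
  using rank_pos[OF pos_zero] by blast

lemma act_k: "X \<in> V \<Longrightarrow> act X k p = 0"
  by (rule act_eq_0_if_horizontal[OF k_C act_pos_k act_neg_k pos_neg_pairing])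

lemma nu_eq_0: "nu p = 0"
  using act_xi_k[of p] act_k[of \<xi> p] one_plus_k_ne[of p] by simp

text \<open>Second Bianchi identity for \<open>X\<close>, \<open>Y\<close>, \<open>\<xi>\<close>
  applied to \<open>\<xi>\<close> and paired with \<open>W\<close>. With k constant and nu = 0 the k
  terms agree on both sides, and the terms with undifferentiated m agree by
  \<open>D_P_mixed\<close>. The term with Y(m) dies because \<open>P X\<close> and \<open>W\<close>
  both lie in D-.\<close>

lemma act_pos_m_pairing:
  assumes X: "pos X" and Y: "neg Y" and W: "neg W"
  shows "act X m p * G (P Y) W p = 0"
proof -
  note [simp] = X[THEN pos_V] Y[THEN neg_V] W[THEN neg_V]
  have n: "neg (P X)" "pos (P Y)" "pos (P W)" using X Y W pos_P neg_P by auto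
  \<comment> \<open>P exchanges the eigenbundles, so h = phi P is -P on D+ and P on D-; hence the
    opposite signs of m here and in \<open>cY\<close>.\<close>
  have cX: "curv X \<xi> \<xi> = mul k X - mul m (P X)"
    using X n by (intro G_eqI) (simp_all add: curv_xi nu_eq_0 G_lin neg_ph)
  have cY: "curv Y \<xi> \<xi> = mul k Y + mul m (P Y)"
    using Y n by (intro G_eqI) (simp_all add: curv_xi nu_eq_0 G_lin pos_ph)
  have cXY: "curv X Y \<xi> = 0"
    using X Y by (intro G_eqI) (simp_all add: curv_xi)
  have c1: "G (curv (br X Y) \<xi> \<xi>) W p = k p * G (br X Y) W p + m p * G (br X Y) (P W) p"
    using W neg_ph[OF W] by (simp add: curv_xi nu_eq_0 G_ph G_P G_minus_right)
  have c2: "G (curv (br Y \<xi>) X \<xi>) W p = 0" "G (curv (br \<xi> X) Y \<xi>) W p = 0"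
  proof -
    have "br \<xi> X = - br X \<xi>" by (simp add: br_def)
    then show "G (curv (br Y \<xi>) X \<xi>) W p = 0" "G (curv (br \<xi> X) Y \<xi>) W p = 0"
      using X Y by (simp_all add: curv_xi eta_br_xi G_minus_left)
  qed
  \<comment> \<open>Pair symmetry moves \<open>\<xi>\<close> into the last slot: up to sign this is
    \<open>curv A W \<xi>\<close> against \<open>B\<close>, which vanishes since eta is 0 on
    \<open>A\<close> at \<open>p\<close> and on \<open>W\<close>.\<close>
  have c3: "G (curv B \<xi> A) W p = 0"
    if "A \<in> V" "G A \<xi> p = 0" "B \<in> V" for A B
    using curv_pair_swap[of B \<xi> A W p] curv_skew[of A W B \<xi> p] curv_xi[of A W B p] that W
      G_sym[of "curv A W B" \<xi> p] G_sym[of B "curv A W \<xi>" p]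
    by simp
  have c4: "G (curv \<xi> X (D Y \<xi>)) W p = 0"
    using c3[of "D Y \<xi>" X] by (simp add: curv_swap[of X \<xi>] G_minus_left G_D_xi_xi)
  have c5: "D \<xi> (curv X Y \<xi>) = 0" "curv X Y (D \<xi> \<xi>) = 0" "curv \<xi> X \<xi> = - curv X \<xi> \<xi>"
    unfolding cXY D_xi_xi by (simp_all add: curv_swap[of X \<xi>]) (simp add: curv_def)
  have "G (D X (curv Y \<xi> \<xi>)) W p + G (D Y (curv \<xi> X \<xi>)) W p =
      k p * G (br X Y) W p + m p * G (br X Y) (P W) p"
    using arg_cong[OF curv_second_bianchi[of X Y \<xi> \<xi>], of "\<lambda>U. G U W p"] c1 c2 c4 c5 c3[of "D X \<xi>" Y]
    by (simp add: G_lin G_D_xi_xi)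
  then show ?thesis
    using D_P_mixed[OF X Y W, of p] D_neg_isotropic[OF Y n(1) W, of p] neg_iso[OF n(1) W, of p] 
      neg_iso[OF Y W, of p]
    by (simp add: c5 cX cY D_lin D_mul_right G_lin act_k) (simp add: br_def G_lin algebra_simps)
qed

lemma act_pos_m:
  assumes X: "pos X"
  shows "act X m p = 0"
proof -
  obtain Y Z where YZ: "pos Y" "neg Z" "G Y Z p \<noteq> 0" using pos_neg_pairing by blast
  \<comment> \<open>Feeding in \<open>P Y\<close> makes the pairing -(1 + k) \<open>G Y Z\<close>,
    which is nonzero.\<close>
  have "act X m p * G (P (P Y)) Z p = 0"
    using act_pos_m_pairing[OF X pos_P[OF YZ(1)] YZ(2)] .
  then have "act X m p * ((1 + k p) * G Y Z p) = 0"
    using YZ by (simp add: P_P_pos G_lin algebra_simps)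
  then show ?thesis using YZ one_plus_k_ne[of p] by simp
qed

lemma act_neg_m: "neg X \<Longrightarrow> act X m p = 0"
  using kmn_module.act_pos_m[OF dual_kmn] by (simp add: dual_pos)

lemma act_m: "X \<in> V \<Longrightarrow> act X m p = 0"
  by (rule act_eq_0_if_horizontal[OF m_C act_pos_m act_neg_m pos_neg_pairing])

end

subsection \<open>Vector fields of a paracontact metric manifold\<close>

text \<open>Extension of tangent vectors turns the pointwise nondegeneracy of \<open>g\<close> into
  \<open>G_nondeg\<close>, which tests against fields.\<close>

lemma (in smooth_mfd) levi_civita_module:
  assumes metric: "pseudo_riemannian_metric A g" and lc: "levi_civita A g D"
    and ext: "\<And>p v. v \<in> tangent_space A p \<Longrightarrow> \<exists>X\<in>vector_fields A. X p = v"
  shows "levi_civita_module (smooth_funs A) (vector_fields A) fmult (\<lambda>X f p. X p f) D (eval2 g)"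
proof -
  note t = vector_fields_tangent
  have aff: "affine_connection A D" using lc by (simp add: levi_civita_def)
  have DV: "D X Y \<in> vector_fields A" if "X \<in> vector_fields A" "Y \<in> vector_fields A" for X Y
    using aff that by (simp add: affine_connection_def)
  have br: "D X Y - D Y X = lie_bracket X Y" if "X \<in> vector_fields A" "Y \<in> vector_fields A" for X Y
    using lc that by (simp add: levi_civita_def)
  have neg: "- X \<in> vector_fields A" if "X \<in> vector_fields A" for X
    using vector_fields_scaleR[OF that, of "-1"] by simp
  \<comment> \<open>Closure under brackets is read off from torsion-freeness, without a computation
    in charts.\<close>
  have brV: "lie_bracket X Y \<in> vector_fields A" if "X \<in> vector_fields A" "Y \<in> vector_fields A" for X Y
    using vector_fields_plus[OF DV[OF that] neg[OF DV[OF that(2,1)]]] br[OF that] by simp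
  have g_add: "g p (u + v) w = g p u w + g p v w"
    if "u \<in> tangent_space A p" "v \<in> tangent_space A p" "w \<in> tangent_space A p" for p u v w
    using metric that by (simp add: pseudo_riemannian_metric_def)
  have g_scale: "g p (r *\<^sub>R v) w = r * g p v w"
    if "v \<in> tangent_space A p" "w \<in> tangent_space A p" for p r v w
    using metric that by (simp add: pseudo_riemannian_metric_def)
  have g_sym: "g p v w = g p w v" if "v \<in> tangent_space A p" "w \<in> tangent_space A p" for p v w
    using metric[unfolded pseudo_riemannian_metric_def, THEN conjunct2, THEN conjunct2, THEN conjunct1] that
    by blast
  have g_nondeg: "v = 0" if "v \<in> tangent_space A p" "\<And>w. w \<in> tangent_space A p \<Longrightarrow> g p v w = 0" for p v
    using metric[unfolded pseudo_riemannian_metric_def, THEN conjunct2, THEN conjunct2, THEN conjunct2, THEN conjunct1] that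
    by blast
  show ?thesis
  proof
    fix X Y Z :: "'a vfield" and f h p r
    show "(\<lambda>p. r) \<in> smooth_funs A" by (rule smooth_funs_const)
    show "0 \<in> vector_fields A" by (rule vector_fields_0)
    { assume "f \<in> smooth_funs A" "h \<in> smooth_funs A"
      then show "(\<lambda>p. f p + h p) \<in> smooth_funs A" "(\<lambda>p. f p * h p) \<in> smooth_funs A"
        using smooth_funs_add smooth_funs_mult by auto }
    assume X: "X \<in> vector_fields A"
    show "fmult (\<lambda>p. r) X = r *\<^sub>R X" by (rule fmult_const)
    show "X p (\<lambda>p. r) = 0" by (rule tangent_const[OF t[OF X]])
    { assume "\<And>Y p. Y \<in> vector_fields A \<Longrightarrow> eval2 g X Y p = 0"
      then have "X p = 0" for p
        using g_nondeg[OF t[OF X]] ext[of _ p] unfolding eval2_def by metis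
      then show "X = 0" by (simp add: fun_eq_iff) }
    { assume f: "f \<in> smooth_funs A"
      show "fmult f X \<in> vector_fields A" by (rule vector_fields_fmult[OF f X])
      show "(\<lambda>p. X p f) \<in> smooth_funs A" by (rule vector_fields_smooth[OF X f])
      assume h: "h \<in> smooth_funs A"
      show "X p (\<lambda>p. f p + h p) = X p f + X p h" by (rule tangent_add[OF t[OF X] f h])
      show "X p (\<lambda>p. f p * h p) = f p * X p h + h p * X p f" by (rule tangent_mult[OF t[OF X] f h])
      show "fmult h X p f = h p * X p f" by (rule fmult_apply) }
    assume Y: "Y \<in> vector_fields A"
    show "X + Y \<in> vector_fields A" by (rule vector_fields_plus[OF X Y])
    show "(X + Y) p f = X p f + Y p f" by simp
    show "D X Y \<in> vector_fields A" by (rule DV[OF X Y])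
    show "eval2 g X Y \<in> smooth_funs A" using metric X Y by (simp add: pseudo_riemannian_metric_def)
    show "eval2 g X Y p = eval2 g Y X p" unfolding eval2_def by (rule g_sym[OF t[OF X] t[OF Y]])
    show "(D X Y - D Y X) p f = X p (\<lambda>q. Y q f) - Y p (\<lambda>q. X q f)"
      unfolding br[OF X Y] lie_bracket_apply ..
    { assume f: "f \<in> smooth_funs A"
      show "D (fmult f X) Y = fmult f (D X Y)" "D X (fmult f Y) = fmult (\<lambda>p. X p f) Y + fmult f (D X Y)"
        using aff X Y f by (simp_all add: affine_connection_def)
      show "eval2 g (fmult f X) Y p = f p * eval2 g X Y p"
        unfolding eval2_def fmult_def by (rule g_scale[OF t[OF X] t[OF Y]]) }
    assume Z: "Z \<in> vector_fields A"
    show "D (X + Y) Z = D X Z + D Y Z" "D X (Y + Z) = D X Y + D X Z"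
      using aff X Y Z by (simp_all add: affine_connection_def)
    show "eval2 g (X + Y) Z p = eval2 g X Z p + eval2 g Y Z p"
      using g_add[OF t[OF X] t[OF Y] t[OF Z], of p] by (simp add: eval2_def plus_fun_def)
    show "X p (eval2 g Y Z) = eval2 g (D X Y) Z p + eval2 g Y (D X Z) p"
      using lc X Y Z by (simp add: levi_civita_def)
    show "D (D X Y - D Y X) Z - D Z (D X Y - D Y X) + (D (D Y Z - D Z Y) X - D X (D Y Z - D Z Y)) +
        (D (D Z X - D X Z) Y - D Y (D Z X - D X Z)) = 0"
      unfolding br[OF X Y] br[OF Y Z] br[OF Z X] br[OF brV[OF X Y] Z] br[OF brV[OF Y Z] X] br[OF brV[OF Z X] Y]
      by (rule lie_bracket_jacobi[OF X Y Z brV[OF X Y] brV[OF Y Z] brV[OF Z X]])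
  qed
qed

lemma half_scaleR_double: "(1/2) *\<^sub>R (v + v) = v" for v :: "'v::real_vector"
  by (simp flip: scaleR_2)

lemma not_subset_span_singleton:
  fixes V :: "'v::real_vector set"
  assumes "dim V > 1" shows "\<exists>y\<in>V. y \<notin> span {x}"
proof (rule ccontr)
  assume "\<not> ?thesis"
  then have "V \<subseteq> span {x}" by blast
  then have "dim V \<le> card {x}" by (intro dim_le_card) auto
  then show False using assms by simp
qed

text \<open>Since phi^2 xi = 0, computing phi^3 xi in two ways gives phi xi = c xi, and then c^2 xi
  = 0. Computing phi^3 v in two ways gives eta(phi v) = 0. Both facts are pointwise, since they are
  used to establish the extension of tangent vectors.\<close>

lemma (in smooth_mfd)
  assumes pm: "paracontact_metric_manifold n A \<phi> \<xi> \<eta> g"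
  shows paracontact_phi_xi: "\<phi> p (\<xi> p) = 0"
    and paracontact_eta_phi: "v \<in> tangent_space A p \<Longrightarrow> \<eta> p (\<phi> p v) = 0"
proof -
  note t = vector_fields_tangent
  have endo: "is_endo_field A \<phi>" and xi: "\<xi> \<in> vector_fields A" and eta: "is_one_form A \<eta>"
    and eta_xi: "\<And>p. \<eta> p (\<xi> p) = 1"
    and phi_phi: "\<And>p v. v \<in> tangent_space A p \<Longrightarrow> \<phi> p (\<phi> p v) = v - \<eta> p v *\<^sub>R \<xi> p"
    using pm by (simp_all add: paracontact_metric_manifold_def)
  have phi_T: "\<phi> p v \<in> tangent_space A p" if "v \<in> tangent_space A p" for p v
    using endo that by (simp add: is_endo_field_def)
  have phi_add: "\<phi> p (v + w) = \<phi> p v + \<phi> p w" if "v \<in> tangent_space A p" "w \<in> tangent_space A p" for p v w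
    using endo that by (simp add: is_endo_field_def)
  have phi_scale: "\<phi> p (r *\<^sub>R v) = r *\<^sub>R \<phi> p v" if "v \<in> tangent_space A p" for p v r
    using endo that by (simp add: is_endo_field_def)
  note xiT = t[OF xi]
  have xi_ne: "\<xi> p \<noteq> 0" for p
    using eta_xi[of p] eta xiT[of p] unfolding is_one_form_def by (metis mult_zero_left scaleR_zero_left zero_neq_one)
  show phi_xi: "\<phi> p (\<xi> p) = 0" for p
  proof -
    have T: "\<phi> p (\<xi> p) \<in> tangent_space A p" by (rule phi_T[OF xiT])
    define c where "c = \<eta> p (\<phi> p (\<xi> p))"
    have z: "\<phi> p (\<phi> p (\<xi> p)) = 0" using phi_phi[OF xiT, of p] by (simp add: eta_xi)
    have phi0: "\<phi> p 0 = 0" using phi_scale[OF tangent_space_0, of p 0] by simp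
    have "\<phi> p (\<phi> p (\<phi> p (\<xi> p))) = \<phi> p (\<xi> p) - c *\<^sub>R \<xi> p"
      using phi_phi[OF T] by (simp add: c_def)
    then have c: "\<phi> p (\<xi> p) = c *\<^sub>R \<xi> p" by (simp only: z phi0) simp
    then have "c *\<^sub>R c *\<^sub>R \<xi> p = 0" using z phi_scale[OF xiT] by metis
    then have "c = 0" using xi_ne[of p] by simp
    then show ?thesis using c by simp
  qed
  show "\<eta> p (\<phi> p v) = 0" if v: "v \<in> tangent_space A p" for p v
  proof -
    have "\<phi> p (\<phi> p (\<phi> p v)) = \<phi> p v - \<eta> p (\<phi> p v) *\<^sub>R \<xi> p"
      by (rule phi_phi[OF phi_T[OF v]])
    moreover have "\<phi> p (\<phi> p (\<phi> p v)) = \<phi> p v + (- \<eta> p v) *\<^sub>R \<phi> p (\<xi> p)"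
      unfolding phi_phi[OF v] 
      using phi_add[OF v tangent_space_scaleR[OF xiT], of "- \<eta> p v"] phi_scale[OF xiT, of p "- \<eta> p v"] by simp
    ultimately have "\<eta> p (\<phi> p v) *\<^sub>R \<xi> p = 0" by (simp add: phi_xi)
    then show ?thesis using xi_ne[of p] by simp
  qed
qed

lemma (in smooth_mfd) paracontact_module:
  assumes pm: "paracontact_metric_manifold n A \<phi> \<xi> \<eta> g" and lc: "levi_civita A g D"
    and ext: "\<And>p v. v \<in> tangent_space A p \<Longrightarrow> \<exists>X\<in>vector_fields A. X p = v"
  shows "paracontact_module (smooth_funs A) (vector_fields A) fmult (\<lambda>X f p. X p f) D (eval2 g) (app \<phi>) \<xi>"
    and "\<And>X. X \<in> vector_fields A \<Longrightarrow> eval1 \<eta> X = eval2 g X \<xi>"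
proof -
  note t = vector_fields_tangent
  have endo: "is_endo_field A \<phi>" and xi: "\<xi> \<in> vector_fields A" and eta: "is_one_form A \<eta>"
    and metric: "pseudo_riemannian_metric A g" and eta_xi: "\<And>p. \<eta> p (\<xi> p) = 1"
    and phi_phi: "\<And>p v. v \<in> tangent_space A p \<Longrightarrow> \<phi> p (\<phi> p v) = v - \<eta> p v *\<^sub>R \<xi> p"
    and g_phi_phi: "\<And>p v w. v \<in> tangent_space A p \<Longrightarrow> w \<in> tangent_space A p \<Longrightarrow>
      g p (\<phi> p v) (\<phi> p w) = - g p v w + \<eta> p v * \<eta> p w"
    and d_eta: "\<And>X Y p. X \<in> vector_fields A \<Longrightarrow> Y \<in> vector_fields A \<Longrightarrow> ext_deriv \<eta> X Y p = eval2 g X (app \<phi> Y) p"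
    using pm by (simp_all add: paracontact_metric_manifold_def)
  interpret levi_civita_module "smooth_funs A" "vector_fields A" fmult "\<lambda>X f p. X p f" D "eval2 g"
    by (rule levi_civita_module[OF metric lc ext])
  have phi_T: "\<phi> p v \<in> tangent_space A p" if "v \<in> tangent_space A p" for p v
    using endo that by (simp add: is_endo_field_def)
  have phi_add: "\<phi> p (v + w) = \<phi> p v + \<phi> p w" if "v \<in> tangent_space A p" "w \<in> tangent_space A p" for p v w
    using endo that by (simp add: is_endo_field_def)
  have phi_scale: "\<phi> p (r *\<^sub>R v) = r *\<^sub>R \<phi> p v" if "v \<in> tangent_space A p" for p v r
    using endo that by (simp add: is_endo_field_def)
  have phi_V: "app \<phi> X \<in> vector_fields A" if "X \<in> vector_fields A" for X
    using endo that by (simp add: is_endo_field_def)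
  have g_scale: "g p (r *\<^sub>R v) w = r * g p v w"
    if "v \<in> tangent_space A p" "w \<in> tangent_space A p" for p r v w
    using metric that by (simp add: pseudo_riemannian_metric_def)
  note xiT = t[OF xi]
  note phi_xi = paracontact_phi_xi[OF pm] and eta_phi = paracontact_eta_phi[OF pm]
  have g_zero: "g p v 0 = 0" if "v \<in> tangent_space A p" for p v
  proof -
    have "g p v 0 = g p 0 v"
      using metric[unfolded pseudo_riemannian_metric_def, THEN conjunct2, THEN conjunct2, THEN conjunct1]
        that tangent_space_0[of p] by blast
    then show ?thesis using g_scale[OF tangent_space_0 that, of 0] by simp
  qed
  have g_xi: "g p v (\<xi> p) = \<eta> p v" if v: "v \<in> tangent_space A p" for p v
    using g_phi_phi[OF v xiT] g_zero[OF phi_T[OF v]] by (simp add: phi_xi eta_xi)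
  have eta_eq: "\<eta> p (X p) = eval2 g X \<xi> p" if "X \<in> vector_fields A" for X p
    using g_xi[OF t[OF that], of p] by (simp add: eval2_def)
  show eval1_eta: "eval1 \<eta> X = eval2 g X \<xi>" if "X \<in> vector_fields A" for X
    using eta_eq[OF that] by (simp add: eval1_def fun_eq_iff)
  have phi_phi_V: "app \<phi> (app \<phi> X) = X - fmult (eval2 g X \<xi>) \<xi>" if "X \<in> vector_fields A" for X
  proof
    fix p
    show "app \<phi> (app \<phi> X) p = (X - fmult (eval2 g X \<xi>) \<xi>) p"
      using phi_phi[OF t[OF that], of p] eta_eq[OF that, of p] by (simp add: app_def fmult_def)
  qed
  show "paracontact_module (smooth_funs A) (vector_fields A) fmult (\<lambda>X f p. X p f) D (eval2 g) (app \<phi>) \<xi>"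
  proof
    fix X Y :: "'a vfield" and f p
    show "\<xi> \<in> vector_fields A" by (rule xi)
    show "eval2 g \<xi> \<xi> p = 1" using eta_eq[OF xi, of p] eta_xi[of p] by simp
    show "app \<phi> \<xi> = 0" using phi_xi by (simp add: app_def fun_eq_iff)
    assume X: "X \<in> vector_fields A"
    show "app \<phi> X \<in> vector_fields A" by (rule phi_V[OF X])
    show "app \<phi> (app \<phi> X) = X - fmult (eval2 g X \<xi>) \<xi>" by (rule phi_phi_V[OF X])
    { assume "f \<in> smooth_funs A"
      show "app \<phi> (fmult f X) = fmult f (app \<phi> X)"
        unfolding app_def fmult_def phi_scale[OF t[OF X]] .. }
    assume Y: "Y \<in> vector_fields A"
    show "app \<phi> (X + Y) = app \<phi> X + app \<phi> Y"
    proof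
      fix p
      have "(X + Y) p = X p + Y p" by (simp add: plus_fun_def)
      then show "app \<phi> (X + Y) p = (app \<phi> X + app \<phi> Y) p"
        using phi_add[OF t[OF X] t[OF Y], of p] by (simp add: app_def)
    qed
    \<comment> \<open>Skewness of phi: compatibility is applied to \<open>X\<close> and phi
      \<open>Y\<close>, and phi^2 \<open>Y\<close> differs from \<open>Y\<close> by a multiple of
      xi, to which phi \<open>X\<close> is orthogonal.\<close>
    have "eval2 g (app \<phi> X) (app \<phi> (app \<phi> Y)) p = - eval2 g X (app \<phi> Y) p"
      using g_phi_phi[OF t[OF X] phi_T[OF t[OF Y]], of p] eta_phi[OF t[OF Y], of p]
      by (simp add: eval2_def app_def)
    moreover have "eval2 g (app \<phi> X) \<xi> p = 0"
      using eta_eq[OF phi_V[OF X], of p] eta_phi[OF t[OF X], of p] by (simp add: app_def)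
    ultimately show "eval2 g (app \<phi> X) Y p = - eval2 g X (app \<phi> Y) p"
      using G_diff_right[OF phi_V[OF X] Y V_mul[OF G_C[OF Y xi] xi], of p]
        G_mul_right[OF G_C[OF Y xi] phi_V[OF X] xi, of p]
      unfolding phi_phi_V[OF Y] by simp
    have br: "lie_bracket X Y = D X Y - D Y X" using lc X Y by (simp add: levi_civita_def)
    have "D X Y - D Y X \<in> vector_fields A" using X Y by simp
    then have "\<eta> p (lie_bracket X Y p) = eval2 g (D X Y - D Y X) \<xi> p"
      unfolding br by (rule eta_eq)
    then show "X p (eval2 g Y \<xi>) - Y p (eval2 g X \<xi>) - eval2 g (D X Y - D Y X) \<xi> p = 2 * eval2 g X (app \<phi> Y) p"
      using d_eta[OF X Y, of p] unfolding ext_deriv_def eval1_eta[OF X] eval1_eta[OF Y] by simp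
  qed
qed

text \<open>Bases of the two eigenspaces together with xi span the tangent space: w = eta(w) xi + (u
  + phi u)/2 + (u - phi u)/2 with u the part of w in ker eta. This bounds its dimension by 2n + 1,
  as \<open>tangent_extend\<close> requires.\<close>

lemma (in smooth_mfd) paracontact_extend:
  assumes pm: "paracontact_metric_manifold n A \<phi> \<xi> \<eta> g" and n: "n > 0"
    and v: "v \<in> tangent_space A p"
  shows "\<exists>X\<in>vector_fields A. X p = v"
proof -
  let ?T = "tangent_space A p"
  let ?E = "\<lambda>s. {v \<in> ?T. \<eta> p v = 0 \<and> \<phi> p v = s *\<^sub>R v}"
  have endo: "is_endo_field A \<phi>" and xi: "\<xi> \<in> vector_fields A" and eta: "is_one_form A \<eta>"
    and dim: "DIM('e) = 2 * n + 1"
    and eta_xi: "\<eta> p (\<xi> p) = 1"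
    and phi_phi: "\<And>v. v \<in> ?T \<Longrightarrow> \<phi> p (\<phi> p v) = v - \<eta> p v *\<^sub>R \<xi> p"
    and dims: "dim (?E 1) = n" "dim (?E (-1)) = n"
    using pm by (simp_all add: paracontact_metric_manifold_def)
  have phi_T: "\<phi> p v \<in> ?T" if "v \<in> ?T" for v
    using endo that by (simp add: is_endo_field_def)
  have phi_add: "\<phi> p (v + w) = \<phi> p v + \<phi> p w" if "v \<in> ?T" "w \<in> ?T" for v w
    using endo that by (simp add: is_endo_field_def)
  have phi_scale: "\<phi> p (r *\<^sub>R v) = r *\<^sub>R \<phi> p v" if "v \<in> ?T" for v r
    using endo that by (simp add: is_endo_field_def)
  have eta_add: "\<eta> p (v + w) = \<eta> p v + \<eta> p w" if "v \<in> ?T" "w \<in> ?T" for v w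
    using eta that by (simp add: is_one_form_def)
  have eta_scale: "\<eta> p (r *\<^sub>R v) = r * \<eta> p v" if "v \<in> ?T" for v r
    using eta that by (simp add: is_one_form_def)
  have xiT: "\<xi> p \<in> ?T" by (rule vector_fields_tangent[OF xi])
  obtain B where "B \<subseteq> ?E 1" "independent B" and B: "?E 1 \<subseteq> span B" "card B = dim (?E 1)"
    by (rule basis_exists)
  obtain B' where "B' \<subseteq> ?E (-1)" "independent B'" and B': "?E (-1) \<subseteq> span B'" "card B' = dim (?E (-1))"
    by (rule basis_exists)
  let ?W = "insert (\<xi> p) (B \<union> B')"
  \<comment> \<open>Infinite sets have cardinality 0, so n > 0 forces both bases to be
    finite.\<close>
  have fin: "finite B" "finite B'" using B(2) B'(2) n unfolding dims by (auto intro: card_ge_0_finite)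
  have card: "card ?W \<le> DIM('e)"
    using card_insert_le_m1[of "2 * n + 1" "B \<union> B'" "\<xi> p"] card_Un_le[of B B'] B(2) B'(2) dim unfolding dims by simp
  have "?T \<subseteq> span ?W"
  proof
    fix w assume w: "w \<in> ?T"
    define u where "u = w + (- \<eta> p w) *\<^sub>R \<xi> p"
    have u: "u \<in> ?T" unfolding u_def by (rule tangent_space_plus[OF w tangent_space_scaleR[OF xiT]])
    have phi_u: "\<phi> p u = \<phi> p w"
      unfolding u_def phi_add[OF w tangent_space_scaleR[OF xiT]] phi_scale[OF xiT] paracontact_phi_xi[OF pm] by simp
    have eta_u: "\<eta> p u = 0"
      unfolding u_def eta_add[OF w tangent_space_scaleR[OF xiT]] eta_scale[OF xiT] eta_xi by simp
    have E: "u + s *\<^sub>R \<phi> p u \<in> ?E s" if "s * s = 1" for s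
    proof -
      have "\<phi> p (\<phi> p u) = u" using phi_phi[OF u] by (simp add: eta_u)
      then have "\<phi> p (u + s *\<^sub>R \<phi> p u) = s *\<^sub>R (u + s *\<^sub>R \<phi> p u)"
        using phi_add[OF u tangent_space_scaleR[OF phi_T[OF u]], of s] phi_scale[OF phi_T[OF u], of s] that
        by (simp add: scaleR_add_right)
      moreover have "\<eta> p (u + s *\<^sub>R \<phi> p u) = 0"
        using eta_add[OF u tangent_space_scaleR[OF phi_T[OF u]], of s] eta_scale[OF phi_T[OF u], of s]
          paracontact_eta_phi[OF pm u] eta_u by simp
      ultimately show ?thesis
        using tangent_space_plus[OF u tangent_space_scaleR[OF phi_T[OF u]], of s] by simp
    qed
    have plus: "u + 1 *\<^sub>R \<phi> p u \<in> span ?W"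
      by (rule subsetD[OF span_mono subsetD[OF B(1) E]]) auto
    have minus: "u + (-1) *\<^sub>R \<phi> p u \<in> span ?W"
      by (rule subsetD[OF span_mono subsetD[OF B'(1) E]]) auto
    have "(1/2) *\<^sub>R ((u + 1 *\<^sub>R \<phi> p u) + (u + (-1) *\<^sub>R \<phi> p u)) + \<eta> p w *\<^sub>R \<xi> p \<in> span ?W"
      by (rule span_add[OF span_scale[OF span_add[OF plus minus]] span_scale[OF span_base]]) simp
    moreover have "(u + 1 *\<^sub>R \<phi> p u) + (u + (-1) *\<^sub>R \<phi> p u) = u + u" by simp
    ultimately have "u + \<eta> p w *\<^sub>R \<xi> p \<in> span ?W" by (simp only: half_scaleR_double)
    then show "w \<in> span ?W" by (simp add: u_def)
  qed
  with fin card v obtain X where "X \<in> vector_fields A" "X p = v"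
    using tangent_extend[of ?W p v] by auto
  then show ?thesis by blast
qed

theorem theorem3p9:
  fixes A :: "('a::{t2_space,second_countable_topology}, 'e::euclidean_space) atlas"
    and \<phi> :: "'a endo_field" and \<xi> :: "'a vfield" and \<eta> :: "'a one_form" and g :: "'a bilin_field"
    and D :: "'a vfield \<Rightarrow> 'a vfield \<Rightarrow> 'a vfield"
    and \<kappa> \<mu> \<nu> lam :: "'a \<Rightarrow> real"
    and n :: nat
  assumes manifold: "paracontact_kmn_manifold n A \<phi> \<xi> \<eta> g D \<kappa> \<mu> \<nu>"
    and conn: "connected (UNIV :: 'a set)"
    and n_gt: "n > 1"
    and kappa_ne: "\<forall>p. \<kappa> p \<noteq> -1"
    and lam: "lam = (\<lambda>p. sqrt \<bar>1 + \<kappa> p\<bar>)"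
    and index_h: "(\<forall>p. \<kappa> p > -1) \<Longrightarrow>
           constant_eigen_index A g (h_tensor \<phi> \<xi>) lam \<and>
           constant_eigen_index A g (h_tensor \<phi> \<xi>) (\<lambda>p. - lam p)"
    and index_phi_h: "(\<forall>p. \<kappa> p < -1) \<Longrightarrow>
           constant_eigen_index A g (\<lambda>X. app \<phi> (h_tensor \<phi> \<xi> X)) lam \<and>
           constant_eigen_index A g (\<lambda>X. app \<phi> (h_tensor \<phi> \<xi> X)) (\<lambda>p. - lam p)"
  shows "(\<exists>k. \<forall>p. \<kappa> p = k) \<and> (\<exists>m. \<forall>p. \<mu> p = m) \<and> (\<forall>p. \<nu> p = 0)"
proof -
  have pm: "paracontact_metric_manifold n A \<phi> \<xi> \<eta> g" and lc: "levi_civita A g D"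
    and smooth: "\<kappa> \<in> smooth_funs A" "\<mu> \<in> smooth_funs A" "\<nu> \<in> smooth_funs A"
    using manifold by (simp_all add: paracontact_kmn_manifold_def)
  interpret smooth_mfd A using pm by unfold_locales (simp add: paracontact_metric_manifold_def)
  have "n > 0" using n_gt by simp
  note ext = paracontact_extend[OF pm this]
  let ?V = "vector_fields A" and ?ph = "app \<phi>" and ?G = "eval2 g"
  interpret paracontact_module "smooth_funs A" ?V fmult "\<lambda>X f p. X p f" D ?G ?ph \<xi>
    by (rule paracontact_module(1)[OF pm lc ext])
  have eta: "eval1 \<eta> X = ?G X \<xi>" if "X \<in> ?V" for X
    by (rule paracontact_module(2)[OF pm lc ext that])
  have bracket: "lie_bracket X Y = br X Y" if "X \<in> ?V" "Y \<in> ?V" for X Y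
    using lc that by (simp add: levi_civita_def br_def)
  have h: "h_tensor \<phi> \<xi> X = ?ph (P X)" if "X \<in> ?V" for X
    using h_eq_ph_P[OF that] bracket[OF xi_V that] bracket[OF xi_V ph_V[OF that]]
    unfolding h_tensor_def lie_deriv_endo_def by simp
  have nondeg: "v = 0" if "v \<in> tangent_space A p" "\<And>W. W \<in> ?V \<Longrightarrow> g p v (W p) = 0" for p v
  proof -
    have "pseudo_riemannian_metric A g" using lc pm by (simp add: paracontact_metric_manifold_def)
    then have "(\<forall>w\<in>tangent_space A p. g p v w = 0) \<longrightarrow> v = 0"
      using that(1) unfolding pseudo_riemannian_metric_def by simp
    then show ?thesis using that(2) ext by metis
  qed
  have in_span: "Y p \<in> span {X p}" if X: "X \<in> ?V" and Y: "Y \<in> ?V"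
    and c: "\<exists>c. \<forall>W\<in>?V. ?G (Y - c *\<^sub>R X) W p = 0" for X Y p
  proof -
    obtain c where c: "\<forall>W\<in>?V. ?G (Y - c *\<^sub>R X) W p = 0" using c by blast
    have "Y - c *\<^sub>R X \<in> ?V" using X Y by simp
    then have "(Y - c *\<^sub>R X) p = 0"
      using nondeg[OF vector_fields_tangent] c unfolding eval2_def by blast
    then have "Y p = c *\<^sub>R X p" by (simp add: scaleR_fun_def[of c X])
    then show ?thesis using span_scale[OF span_base[of "X p" "{X p}"]] by simp
  qed
  have rank: "\<exists>Y Z. pos Y \<and> neg Z \<and> ?G Y Z p \<noteq> 0 \<and> ?G X Z p = 0" if X: "pos X" for X p
  proof -
    obtain y where y: "y \<in> tangent_space A p" "\<eta> p y = 0" "\<phi> p y = y" "y \<notin> span {X p}"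
      using not_subset_span_singleton[of "{v \<in> tangent_space A p. \<eta> p v = 0 \<and> \<phi> p v = v}" "X p"] pm n_gt
      by (auto simp: paracontact_metric_manifold_def)
    obtain Y where Y: "Y \<in> ?V" "Y p = y" using ext[OF y(1)] by blast
    \<comment> \<open>The extension \<open>Y\<close> need not lie in D+ away from \<open>p\<close>;
      its projection does and still takes the value \<open>y\<close> at \<open>p\<close>.\<close>
    have "pos_part Y p = (1/2) *\<^sub>R (y - ?G Y \<xi> p *\<^sub>R \<xi> p + \<phi> p y)"
      using Y by (simp add: pos_part_def scaleR_fun_def[of _ "_ + _ :: 'a vfield"] fmult_def app_def)
    moreover have "?G Y \<xi> p = 0" using eta[OF Y(1)] Y(2) y(2) by (metis eval1_def)
    ultimately have yp: "pos_part Y p = y" using y(3) half_scaleR_double[of y] by simp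
    \<comment> \<open>If every \<open>Z\<close> orthogonal to \<open>X\<close> at \<open>p\<close>
      were orthogonal to the projection of \<open>Y\<close> too, then \<open>y\<close> would be a
      multiple of \<open>X p\<close>, against its choice.\<close>
    have "\<exists>Z. neg Z \<and> ?G (pos_part Y) Z p \<noteq> 0 \<and> ?G X Z p = 0"
    proof (rule ccontr)
      assume "\<not> ?thesis"
      then have "\<exists>c. \<forall>W\<in>?V. ?G (pos_part Y - c *\<^sub>R X) W p = 0"
        by (intro pos_proportional[OF X pos_part_pos[OF Y(1)]]) blast
      then show False using in_span[of X "pos_part Y" p] X pos_part_pos[OF Y(1)] yp y(4) by simp
    qed
    then show ?thesis using pos_part_pos[OF Y(1)] by blast
  qed
  have rank': "\<exists>Y Z. neg Y \<and> pos Z \<and> ?G Y Z p \<noteq> 0 \<and> ?G X Z p = 0" if X: "neg X" for X p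
  proof -
    obtain y where y: "y \<in> tangent_space A p" "\<eta> p y = 0" "\<phi> p y = - y" "y \<notin> span {X p}"
      using not_subset_span_singleton[of "{v \<in> tangent_space A p. \<eta> p v = 0 \<and> \<phi> p v = - v}" "X p"] pm n_gt
      by (auto simp: paracontact_metric_manifold_def)
    obtain Y where Y: "Y \<in> ?V" "Y p = y" using ext[OF y(1)] by blast
    have "neg_part Y p = (1/2) *\<^sub>R (y - ?G Y \<xi> p *\<^sub>R \<xi> p - \<phi> p y)"
      using Y by (simp add: neg_part_def scaleR_fun_def[of _ "_ - _ :: 'a vfield"] fmult_def app_def)
    moreover have "?G Y \<xi> p = 0" using eta[OF Y(1)] Y(2) y(2) by (metis eval1_def)
    ultimately have yp: "neg_part Y p = y" using y(3) half_scaleR_double[of y] by simp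
    have "\<exists>Z. pos Z \<and> ?G (neg_part Y) Z p \<noteq> 0 \<and> ?G X Z p = 0"
    proof (rule ccontr)
      assume "\<not> ?thesis"
      then have "\<exists>c. \<forall>W\<in>?V. ?G (neg_part Y - c *\<^sub>R X) W p = 0"
        by (intro neg_proportional[OF X neg_part_neg[OF Y(1)]]) blast
      then show False using in_span[of X "neg_part Y" p] X neg_part_neg[OF Y(1)] yp y(4) by simp
    qed
    then show ?thesis using neg_part_neg[OF Y(1)] by blast
  qed
  interpret kmn_module "smooth_funs A" ?V fmult "\<lambda>X f p. X p f" D ?G ?ph \<xi> \<kappa> \<mu> \<nu>
  proof
    fix X Y Z p
    assume X: "X \<in> ?V" and Y: "Y \<in> ?V" and Z: "Z \<in> ?V"
    have "curv X Y \<xi> =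
      fmult \<kappa> (fmult (?G Y \<xi>) X - fmult (?G X \<xi>) Y) +
      fmult \<mu> (fmult (?G Y \<xi>) (?ph (P X)) - fmult (?G X \<xi>) (?ph (P Y))) +
      fmult \<nu> (fmult (?G Y \<xi>) (P X) - fmult (?G X \<xi>) (P Y))"
      using manifold X Y
      unfolding paracontact_kmn_manifold_def Let_def curv_def curvature_def
      by (simp add: h bracket eta ph_ph_P)
    then show "?G (curv X Y \<xi>) Z p =
      ?G Y \<xi> p * (\<kappa> p * ?G X Z p + \<mu> p * ?G (?ph (P X)) Z p + \<nu> p * ?G (P X) Z p)
      - ?G X \<xi> p * (\<kappa> p * ?G Y Z p + \<mu> p * ?G (?ph (P Y)) Z p + \<nu> p * ?G (P Y) Z p)"
      using X Y Z smooth by (simp add: G_add_left G_diff_left G_mul_left algebra_simps)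
  qed (use smooth kappa_ne rank rank' in auto)
  have "\<exists>k. \<forall>p. \<kappa> p = k" by (rule constant_if_no_derivative[OF conn smooth(1)]) (rule act_k)
  moreover have "\<exists>m. \<forall>p. \<mu> p = m" by (rule constant_if_no_derivative[OF conn smooth(2)]) (rule act_m)
  ultimately show ?thesis using nu_eq_0 by simp
qed

end
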